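(* Let $\Gamma$ be a finite graph and $\mathcal{G} = \{G_u \mid u \in V(\Gamma)\}$ a collection of infinite finitely generated groups indexed by $V(\Gamma)$. Assume that $\Gamma$ is not a join and contains at least two vertices. If the graph product $\Gamma\mathcal{G}$ is coarsely separable by a family of subexponential growth, then, for every $k \geq 0$, there exists a weight $\nu : V(\Gamma) \to \mathbb{N}_{\geq 2}$ with $\nu \geq k$ (that is, $\nu(u) \geq k$ for all $u \in V(\Gamma)$) such that $\Gamma(\nu)$ is coarsely separable by a family of subexponential growth.
   Context: Graphs are simple. A graph is a join if its vertex-set can be partitioned into two non-empty subsets such that every vertex of the first is adjacent to every vertex of the second. The graph product $\Gamma\mathcal{G}$ is the group with relative presentation $\langle G_u \ (u \in V(\Gamma)) \mid [G_u,G_v]=1 \ (\{u,v\} \in E(\Gamma)) \rangle$. For a weight $\nu$, $\Gamma(\nu)$ denotes the graph product $\Gamma\{\mathbb{Z}_{\nu(u)} \mid u \in V(\Gamma)\}$ of finite cyclic groups of orders $\nu(u)$. Factors of graph products are always non-trivial. Coarse separation. Graphs are identified with their vertex-sets with the graph metric. For a metric space $X$, $Z \subseteq X$ and $L \geq 0$, set $Z^{+L} = \{x \in X \mid d(x,Z) \leq L\}$. A subset is $k$-connected if any two of its points are joined by a finite chain of points of the subset with consecutive points at distance $\leq k$; $k$-connected components are maximal $k$-connected subsets. A space $X$ is coarsely separated by a collection $\mathcal{Z}$ of subspaces if there exist $k, L \geq 0$ such that $X$ is $k$-connected and, for every $D \geq 0$, there is $Z \in \mathcal{Z}$ such that $X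 \setminus Z^{+L}$ has at least two $k$-connected components containing points at distance $\geq D$ from $Z$. Growth. For a family $\mathcal{S}$ of subsets of a bounded degree graph $X$, set $V_{\mathcal{S}}(R) = \sup_{s \in S,\, S \in \mathcal{S}} |B_X(s,R) \cap S|$. The family has exponential growth if $\limsup_{r \to \infty} \frac{1}{r} \log V_{\mathcal{S}}(r) > 0$, and subexponential growth otherwise. A finitely generated group is coarsely separable by a family of subexponential growth if one of its Cayley graphs (with respect to a finite generating set) is coarsely separated by a family of subsets of subexponential growth. *)

theory Defs
  imports Complex_Main "HOL-Algebra.Elementary_Groups" "HOL-Library.Extended_Real"
begin

section \<open>Simple graphs\<close>

definition simple_graph :: "'v set \<Rightarrow> 'v set set \<Rightarrow> bool" where
  "simple_graph V E \<longleftrightarrow> E \<subseteq> {e. e \<subseteq> V \<and> card e = 2}"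

definition is_join :: "'v set \<Rightarrow> 'v set set \<Rightarrow> bool" where
  "is_join V E \<longleftrightarrow> (\<exists>A B. A \<noteq> {} \<and> B \<noteq> {} \<and> A \<inter> B = {} \<and> A \<union> B = V \<and>
     (\<forall>a\<in>A. \<forall>b\<in>B. {a, b} \<in> E))"

text \<open>The least length of a walk between two vertices. The value is only meaningful for vertices
  in the same connected component; it is used here for Cayley graphs only, which are connected.\<close>
definition graph_dist :: "'v set set \<Rightarrow> 'v \<Rightarrow> 'v \<Rightarrow> nat" where
  "graph_dist E x y = (LEAST n. (x, y) \<in> {(a, b). {a, b} \<in> E} ^^ n)"


section \<open>Graph products of groups\<close>

definition gp_words :: "'v set \<Rightarrow> ('v \<Rightarrow> ('a, 'b) monoid_scheme) \<Rightarrow> ('v \<times> 'a) list set" where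
  "gp_words V G = lists (SIGMA v:V. carrier (G v))"

text \<open>The congruence on words in the disjoint union of the factors generated by the multiplication
  tables of the factors (which alone would present their free product) together with the relations
  \<open>[G u, G v] = 1\<close> for every edge \<open>{u, v}\<close>.\<close>
inductive gp_cong ::
  "'v set \<Rightarrow> 'v set set \<Rightarrow> ('v \<Rightarrow> ('a, 'b) monoid_scheme) \<Rightarrow> ('v \<times> 'a) list \<Rightarrow> ('v \<times> 'a) list \<Rightarrow> bool"
  for V E G where
  refl: "xs \<in> gp_words V G \<Longrightarrow> gp_cong V E G xs xs"
| sym: "gp_cong V E G xs ys \<Longrightarrow> gp_cong V E G ys xs"
| trans: "gp_cong V E G xs ys \<Longrightarrow> gp_cong V E G ys zs \<Longrightarrow> gp_cong V E G xs zs"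
| append: "gp_cong V E G xs xs' \<Longrightarrow> gp_cong V E G ys ys' \<Longrightarrow> gp_cong V E G (xs @ ys) (xs' @ ys')"
| one: "v \<in> V \<Longrightarrow> gp_cong V E G [(v, \<one>\<^bsub>G v\<^esub>)] []"
| mult: "v \<in> V \<Longrightarrow> g \<in> carrier (G v) \<Longrightarrow> h \<in> carrier (G v) \<Longrightarrow>
    gp_cong V E G [(v, g), (v, h)] [(v, g \<otimes>\<^bsub>G v\<^esub> h)]"
| commute: "u \<in> V \<Longrightarrow> v \<in> V \<Longrightarrow> {u, v} \<in> E \<Longrightarrow> g \<in> carrier (G u) \<Longrightarrow> h \<in> carrier (G v) \<Longrightarrow>
    gp_cong V E G [(u, g), (v, h)] [(v, h), (u, g)]"

definition gp_rel ::
  "'v set \<Rightarrow> 'v set set \<Rightarrow> ('v \<Rightarrow> ('a, 'b) monoid_scheme) \<Rightarrow> ('v \<times> 'a) list rel" where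
  "gp_rel V E G = {(xs, ys). gp_cong V E G xs ys}"

definition graph_product ::
  "'v set \<Rightarrow> 'v set set \<Rightarrow> ('v \<Rightarrow> ('a, 'b) monoid_scheme) \<Rightarrow> ('v \<times> 'a) list set monoid" where
  "graph_product V E G =
     \<lparr>carrier = gp_words V G // gp_rel V E G,
      monoid.mult = (\<lambda>A B. \<Union>a\<in>A. \<Union>b\<in>B. gp_rel V E G `` {a @ b}),
      one = gp_rel V E G `` {[]}\<rparr>"

lemma gp_cong_words:
  assumes "gp_cong V E G xs ys" and "\<And>v. v \<in> V \<Longrightarrow> group (G v)"
  shows "xs \<in> gp_words V G \<and> ys \<in> gp_words V G"
  using assms(1)
proof induction
  case (one v)
  interpret group "G v" by (rule assms(2)[OF one])
  show ?case using one by (simp add: gp_words_def)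
next
  case (mult v g h)
  interpret group "G v" by (rule assms(2)[OF mult(1)])
  show ?case using mult by (simp add: gp_words_def)
qed (auto simp: gp_words_def)

lemma equiv_gp_rel:
  assumes "\<And>v. v \<in> V \<Longrightarrow> group (G v)"
  shows "equiv (gp_words V G) (gp_rel V E G)"
proof (rule equivI)
  show "gp_rel V E G \<subseteq> gp_words V G \<times> gp_words V G"
    using gp_cong_words[where V=V and E=E and G=G] assms by (auto simp: gp_rel_def)
  show "refl_on (gp_words V G) (gp_rel V E G)"
    by (auto simp: refl_on_def gp_rel_def intro: gp_cong.refl)
  show "sym_on UNIV (gp_rel V E G)"
    by (auto simp: sym_def gp_rel_def intro: gp_cong.sym)
  show "trans_on UNIV (gp_rel V E G)"
    by (auto simp: trans_def gp_rel_def intro: gp_cong.trans)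
qed

lemma gp_class_eq_iff:
  assumes "\<And>v. v \<in> V \<Longrightarrow> group (G v)" "xs \<in> gp_words V G" "ys \<in> gp_words V G"
  shows "gp_rel V E G `` {xs} = gp_rel V E G `` {ys} \<longleftrightarrow> gp_cong V E G xs ys"
  using eq_equiv_class_iff[OF equiv_gp_rel[where E=E, OF assms(1)] assms(2,3)]
  by (simp add: gp_rel_def)

lemma gp_class_mult:
  assumes G: "\<And>v. v \<in> V \<Longrightarrow> group (G v)" and xs: "xs \<in> gp_words V G" and ys: "ys \<in> gp_words V G"
  shows "gp_rel V E G `` {xs} \<otimes>\<^bsub>graph_product V E G\<^esub> gp_rel V E G `` {ys}
       = gp_rel V E G `` {xs @ ys}"
proof -
  have eq: "gp_rel V E G `` {a @ b} = gp_rel V E G `` {xs @ ys}"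
    if "a \<in> gp_rel V E G `` {xs}" "b \<in> gp_rel V E G `` {ys}" for a b
  proof -
    have "gp_cong V E G xs a" "gp_cong V E G ys b"
      using that by (simp_all add: gp_rel_def)
    then have "gp_cong V E G (a @ b) (xs @ ys)"
      by (rule gp_cong.append[OF gp_cong.sym gp_cong.sym])
    then have "(a @ b, xs @ ys) \<in> gp_rel V E G"
      by (simp add: gp_rel_def)
    then show ?thesis
      using equiv_class_eq[OF equiv_gp_rel] G by metis
  qed
  have "xs \<in> gp_rel V E G `` {xs}" "ys \<in> gp_rel V E G `` {ys}"
    using xs ys by (simp_all add: gp_rel_def gp_cong.refl)
  then have "(\<Union>a\<in>gp_rel V E G `` {xs}. \<Union>b\<in>gp_rel V E G `` {ys}. gp_rel V E G `` {a @ b})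
      = gp_rel V E G `` {xs @ ys}"
    using eq by blast
  then show ?thesis
    by (simp add: graph_product_def)
qed

theorem group_graph_product:
  assumes G: "\<And>v. v \<in> V \<Longrightarrow> group (G v)"
  shows "group (graph_product V E G)"
proof -
  let ?P = "graph_product V E G"
  let ?c = "\<lambda>xs. gp_rel V E G `` {xs}"
  have car: "A \<in> carrier ?P \<longleftrightarrow> (\<exists>xs\<in>gp_words V G. A = ?c xs)" for A
    by (auto simp: graph_product_def quotient_def)
  have one: "\<one>\<^bsub>?P\<^esub> = ?c []"
    by (simp add: graph_product_def)
  have app: "xs @ ys \<in> gp_words V G" if "xs \<in> gp_words V G" "ys \<in> gp_words V G" for xs ys
    using that by (auto simp: gp_words_def)
  have nil: "[] \<in> gp_words V G"
    by (simp add: gp_words_def)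
  note mul = gp_class_mult[where E=E, OF G]
  have linv: "\<exists>ys\<in>gp_words V G. gp_cong V E G (ys @ xs) []" if "xs \<in> gp_words V G" for xs
    using that
  proof (induction xs)
    case Nil
    then show ?case using nil gp_cong.refl[OF nil] by (intro bexI[of _ "[]"]) auto
  next
    case (Cons a xs)
    obtain v g where a: "a = (v, g)" "v \<in> V" "g \<in> carrier (G v)" and xs: "xs \<in> gp_words V G"
      using Cons.prems by (auto simp: gp_words_def)
    obtain ys where ys: "ys \<in> gp_words V G" "gp_cong V E G (ys @ xs) []"
      using Cons.IH xs by blast
    interpret Gv: group "G v" using G a by blast
    let ?i = "[(v, inv\<^bsub>G v\<^esub> g)]"
    have i: "?i \<in> gp_words V G" using a by (auto simp: gp_words_def)
    have "gp_cong V E G (?i @ [a]) [(v, \<one>\<^bsub>G v\<^esub>)]"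
      using gp_cong.mult[of v V "inv\<^bsub>G v\<^esub> g" G g E] a by auto
    then have "gp_cong V E G (?i @ [a]) []"
      by (rule gp_cong.trans) (rule gp_cong.one, rule a)
    then have "gp_cong V E G ((ys @ (?i @ [a])) @ xs) ((ys @ []) @ xs)"
      by (intro gp_cong.append gp_cong.refl ys xs)
    then have "gp_cong V E G ((ys @ ?i) @ a # xs) []"
      using gp_cong.trans ys(2) by fastforce
    then show ?case using app[OF ys(1) i] by blast
  qed
  show ?thesis
  proof (rule groupI)
    fix A B assume "A \<in> carrier ?P" "B \<in> carrier ?P"
    then show "A \<otimes>\<^bsub>?P\<^esub> B \<in> carrier ?P"
      by (auto simp: car mul intro!: bexI app)
  next
    show "\<one>\<^bsub>?P\<^esub> \<in> carrier ?P" using nil by (auto simp: car one)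
  next
    fix A B C assume "A \<in> carrier ?P" "B \<in> carrier ?P" "C \<in> carrier ?P"
    then show "A \<otimes>\<^bsub>?P\<^esub> B \<otimes>\<^bsub>?P\<^esub> C = A \<otimes>\<^bsub>?P\<^esub> (B \<otimes>\<^bsub>?P\<^esub> C)"
      by (auto simp: car mul app)
  next
    fix A assume "A \<in> carrier ?P"
    then show "\<one>\<^bsub>?P\<^esub> \<otimes>\<^bsub>?P\<^esub> A = A" by (auto simp: car mul one nil)
  next
    fix A assume "A \<in> carrier ?P"
    then obtain xs where xs: "xs \<in> gp_words V G" "A = ?c xs" by (auto simp: car)
    obtain ys where ys: "ys \<in> gp_words V G" "gp_cong V E G (ys @ xs) []"
      using linv xs by blast
    have "?c (ys @ xs) = ?c []"
      using gp_class_eq_iff[where E=E, OF G app[OF ys(1) xs(1)] nil] ys(2) by simp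
    then show "\<exists>B\<in>carrier ?P. B \<otimes>\<^bsub>?P\<^esub> A = \<one>\<^bsub>?P\<^esub>"
      using xs ys(1) by (intro bexI[of _ "?c ys"]) (auto simp: car mul one)
  qed
qed

definition gp_incl ::
  "'v set \<Rightarrow> 'v set set \<Rightarrow> ('v \<Rightarrow> ('a, 'b) monoid_scheme) \<Rightarrow> 'v \<Rightarrow> 'a \<Rightarrow> ('v \<times> 'a) list set" where
  "gp_incl V E G v g = gp_rel V E G `` {[(v, g)]}"

text \<open>The following four lemmas say that \<^const>\<open>graph_product\<close> has the universal property of the
  group with the relative presentation \<open>\<langle>G u (u \<in> V) | [G u, G v] = 1 ({u, v} \<in> E)\<rangle>\<close>.\<close>

lemma gp_incl_hom:
  assumes G: "\<And>v. v \<in> V \<Longrightarrow> group (G v)" and v: "v \<in> V"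
  shows "gp_incl V E G v \<in> hom (G v) (graph_product V E G)"
proof (rule homI)
  fix g assume "g \<in> carrier (G v)"
  then have "[(v, g)] \<in> gp_words V G"
    using v by (auto simp: gp_words_def)
  then show "gp_incl V E G v g \<in> carrier (graph_product V E G)"
    by (simp add: gp_incl_def graph_product_def quotientI)
next
  fix g h assume gh: "g \<in> carrier (G v)" "h \<in> carrier (G v)"
  interpret group "G v" using G v .
  have w: "[(v, x)] \<in> gp_words V G" if "x \<in> carrier (G v)" for x
    using that v by (auto simp: gp_words_def)
  have app: "[(v, g), (v, h)] \<in> gp_words V G"
    using gh v by (auto simp: gp_words_def)
  have "gp_rel V E G `` {[(v, g), (v, h)]} = gp_rel V E G `` {[(v, g \<otimes>\<^bsub>G v\<^esub> h)]}"
    using gp_class_eq_iff[where V=V and E=E and G=G, OF G app w[OF m_closed[OF gh]]]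
      gp_cong.mult[where V=V and E=E and G=G, OF v gh] by blast
  moreover have "gp_incl V E G v g \<otimes>\<^bsub>graph_product V E G\<^esub> gp_incl V E G v h =
      gp_rel V E G `` {[(v, g), (v, h)]}"
    using gp_class_mult[where V=V and E=E and G=G, OF G w[OF gh(1)] w[OF gh(2)]]
    by (simp add: gp_incl_def)
  ultimately show "gp_incl V E G v (g \<otimes>\<^bsub>G v\<^esub> h) =
      gp_incl V E G v g \<otimes>\<^bsub>graph_product V E G\<^esub> gp_incl V E G v h"
    by (simp add: gp_incl_def)
qed

lemma gp_incl_commute:
  assumes G: "\<And>v. v \<in> V \<Longrightarrow> group (G v)" and uv: "u \<in> V" "v \<in> V" "{u, v} \<in> E"
    and gh: "g \<in> carrier (G u)" "h \<in> carrier (G v)"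
  shows "gp_incl V E G u g \<otimes>\<^bsub>graph_product V E G\<^esub> gp_incl V E G v h =
         gp_incl V E G v h \<otimes>\<^bsub>graph_product V E G\<^esub> gp_incl V E G u g"
proof -
  have w: "[(u, g)] \<in> gp_words V G" "[(v, h)] \<in> gp_words V G"
      "[(u, g), (v, h)] \<in> gp_words V G" "[(v, h), (u, g)] \<in> gp_words V G"
    using uv gh by (auto simp: gp_words_def)
  show ?thesis
    unfolding gp_incl_def gp_class_mult[where V=V and E=E and G=G, OF G w(1,2), simplified]
      gp_class_mult[where V=V and E=E and G=G, OF G w(2,1), simplified]
    using gp_class_eq_iff[where V=V and E=E and G=G, OF G w(3,4)] gp_cong.commute[where V=V and E=E and G=G, OF uv gh] by simp
qed

lemma gp_hom_exists:
  assumes G: "\<And>v. v \<in> V \<Longrightarrow> group (G v)" and H: "group H"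
    and f: "\<And>v. v \<in> V \<Longrightarrow> f v \<in> hom (G v) H"
    and comm: "\<And>u v g h. u \<in> V \<Longrightarrow> v \<in> V \<Longrightarrow> {u, v} \<in> E \<Longrightarrow> g \<in> carrier (G u) \<Longrightarrow>
      h \<in> carrier (G v) \<Longrightarrow> f u g \<otimes>\<^bsub>H\<^esub> f v h = f v h \<otimes>\<^bsub>H\<^esub> f u g"
  shows "\<exists>\<phi>\<in>hom (graph_product V E G) H. \<forall>v\<in>V. \<forall>g\<in>carrier (G v). \<phi> (gp_incl V E G v g) = f v g"
proof -
  interpret H: group H by (rule H)
  let ?c = "\<lambda>xs. gp_rel V E G `` {xs}"
  define F where "F = (\<lambda>xs. foldr (\<lambda>(v, g) y. f v g \<otimes>\<^bsub>H\<^esub> y) xs \<one>\<^bsub>H\<^esub>)"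
  have F_simps: "F [] = \<one>\<^bsub>H\<^esub>" "F ((v, g) # xs) = f v g \<otimes>\<^bsub>H\<^esub> F xs" for v g xs
    by (simp_all add: F_def)
  have fc: "f v g \<in> carrier H" if "v \<in> V" "g \<in> carrier (G v)" for v g
    using f[OF that(1)] that(2) by (auto simp: hom_def)
  have Fc: "F xs \<in> carrier H" if "xs \<in> gp_words V G" for xs
    using that by (induction xs) (auto simp: F_simps gp_words_def fc)
  have Fapp: "F (xs @ ys) = F xs \<otimes>\<^bsub>H\<^esub> F ys" if "xs \<in> gp_words V G" "ys \<in> gp_words V G" for xs ys
    using that(1)
  proof (induction xs)
    case Nil
    then show ?case using Fc[OF that(2)] by (simp add: F_simps)
  next
    case (Cons a xs)
    obtain v g where a: "a = (v, g)" "v \<in> V" "g \<in> carrier (G v)" and xs: "xs \<in> gp_words V G"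
      using Cons.prems by (auto simp: gp_words_def)
    show ?case
      using Cons.IH[OF xs] a(1) by (simp add: F_simps H.m_assoc fc[OF a(2,3)] Fc[OF xs] Fc[OF that(2)])
  qed
  have Fcong: "F xs = F ys" if "gp_cong V E G xs ys" for xs ys
    using that
  proof induction
    case (append xs xs' ys ys')
    then show ?case
      using gp_cong_words[where V=V and E=E and G=G, OF append(1) G]
        gp_cong_words[where V=V and E=E and G=G, OF append(2) G] by (simp add: Fapp)
  next
    case (one v)
    interpret Gv: group "G v" by (rule G[OF one])
    show ?case
      using hom_one[OF f[OF one] Gv.is_group H] by (simp add: F_simps)
  next
    case (mult v g h)
    then show ?case
      using hom_mult[OF f[OF mult(1)] mult(2,3)] by (simp add: F_simps fc)
  next
    case (commute u v g h)
    then show ?case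
      using comm[OF commute] by (simp add: F_simps fc)
  qed auto
  define \<phi> where "\<phi> = (\<lambda>A. F (SOME xs. xs \<in> A))"
  have \<phi>: "\<phi> (?c xs) = F xs" if "xs \<in> gp_words V G" for xs
  proof -
    have "xs \<in> ?c xs" using that by (auto simp: gp_rel_def intro: gp_cong.refl)
    then have "(SOME ys. ys \<in> ?c xs) \<in> ?c xs" by (rule someI)
    then show ?thesis using Fcong by (auto simp: \<phi>_def gp_rel_def)
  qed
  have "\<phi> \<in> hom (graph_product V E G) H"
  proof (rule homI)
    fix A assume "A \<in> carrier (graph_product V E G)"
    then obtain xs where xs: "xs \<in> gp_words V G" "A = ?c xs"
      by (auto simp: graph_product_def elim: quotientE)
    then show "\<phi> A \<in> carrier H" using \<phi> Fc by simp
  next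
    fix A B assume "A \<in> carrier (graph_product V E G)" "B \<in> carrier (graph_product V E G)"
    then obtain xs ys where xs: "xs \<in> gp_words V G" "A = ?c xs" and ys: "ys \<in> gp_words V G" "B = ?c ys"
      by (auto simp: graph_product_def elim!: quotientE)
    have "xs @ ys \<in> gp_words V G" using xs ys by (auto simp: gp_words_def)
    then show "\<phi> (A \<otimes>\<^bsub>graph_product V E G\<^esub> B) = \<phi> A \<otimes>\<^bsub>H\<^esub> \<phi> B"
      using xs ys by (simp add: gp_class_mult[where V=V and E=E and G=G, OF G] \<phi> Fapp)
  qed
  moreover have "\<phi> (gp_incl V E G v g) = f v g" if "v \<in> V" "g \<in> carrier (G v)" for v g
  proof -
    have "[(v, g)] \<in> gp_words V G" using that by (auto simp: gp_words_def)
    then show ?thesis using \<phi> fc[OF that] by (simp add: gp_incl_def F_simps)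
  qed
  ultimately show ?thesis by blast
qed

lemma gp_hom_unique:
  assumes G: "\<And>v. v \<in> V \<Longrightarrow> group (G v)" and H: "group H"
    and hom: "\<phi> \<in> hom (graph_product V E G) H" "\<psi> \<in> hom (graph_product V E G) H"
    and eq: "\<And>v g. v \<in> V \<Longrightarrow> g \<in> carrier (G v) \<Longrightarrow>
      \<phi> (gp_incl V E G v g) = \<psi> (gp_incl V E G v g)"
    and A: "A \<in> carrier (graph_product V E G)"
  shows "\<phi> A = \<psi> A"
proof -
  let ?P = "graph_product V E G"
  have P: "group ?P" by (rule group_graph_product[OF G])
  have "\<phi> (gp_rel V E G `` {xs}) = \<psi> (gp_rel V E G `` {xs})" if "xs \<in> gp_words V G" for xs
    using that
  proof (induction xs)
    case Nil
    show ?case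
      using hom_one[OF hom(1) P H] hom_one[OF hom(2) P H] by (simp add: graph_product_def)
  next
    case (Cons a xs)
    obtain v g where a: "a = (v, g)" "v \<in> V" "g \<in> carrier (G v)" and xs: "xs \<in> gp_words V G"
      using Cons.prems by (auto simp: gp_words_def)
    have w: "[(v, g)] \<in> gp_words V G" using a by (auto simp: gp_words_def)
    have c: "gp_rel V E G `` {ys} \<in> carrier ?P" if "ys \<in> gp_words V G" for ys
      using that by (simp add: graph_product_def quotientI)
    have "gp_rel V E G `` {a # xs} = gp_incl V E G v g \<otimes>\<^bsub>?P\<^esub> gp_rel V E G `` {xs}"
      using gp_class_mult[where V=V and E=E and G=G, OF G w xs] a(1) by (simp add: gp_incl_def)
    moreover have "gp_incl V E G v g \<in> carrier ?P" using c[OF w] by (simp add: gp_incl_def)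
    ultimately show ?case
      using hom_mult[OF hom(1) _ c[OF xs]] hom_mult[OF hom(2) _ c[OF xs]] Cons.IH[OF xs] eq[OF a(2,3)]
      by simp
  qed
  then show ?thesis using A by (auto simp: graph_product_def elim!: quotientE)
qed


section \<open>Coarse separation\<close>

text \<open>The distance to a subset is taken in the extended reals, so that the distance to the empty
  set is infinite.\<close>
definition point_dist :: "('x \<Rightarrow> 'x \<Rightarrow> real) \<Rightarrow> 'x \<Rightarrow> 'x set \<Rightarrow> ereal" where
  "point_dist d x Z = (INF z\<in>Z. ereal (d x z))"

definition thickening :: "'x set \<Rightarrow> ('x \<Rightarrow> 'x \<Rightarrow> real) \<Rightarrow> 'x set \<Rightarrow> real \<Rightarrow> 'x set" where
  "thickening X d Z L = {x \<in> X. point_dist d x Z \<le> ereal L}"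

definition k_connected :: "('x \<Rightarrow> 'x \<Rightarrow> real) \<Rightarrow> real \<Rightarrow> 'x set \<Rightarrow> bool" where
  "k_connected d k A \<longleftrightarrow>
     (\<forall>x\<in>A. \<forall>y\<in>A. (x, y) \<in> {(a, b). a \<in> A \<and> b \<in> A \<and> d a b \<le> k}\<^sup>*)"

definition k_component :: "('x \<Rightarrow> 'x \<Rightarrow> real) \<Rightarrow> real \<Rightarrow> 'x set \<Rightarrow> 'x set \<Rightarrow> bool" where
  "k_component d k A C \<longleftrightarrow> C \<subseteq> A \<and> k_connected d k C \<and>
     (\<forall>C'. C \<subseteq> C' \<and> C' \<subseteq> A \<and> k_connected d k C' \<longrightarrow> C' = C)"

definition coarsely_separated :: "'x set \<Rightarrow> ('x \<Rightarrow> 'x \<Rightarrow> real) \<Rightarrow> 'x set set \<Rightarrow> bool" where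
  "coarsely_separated X d \<Z> \<longleftrightarrow>
     (\<forall>Z\<in>\<Z>. Z \<subseteq> X) \<and>
     (\<exists>k\<ge>0. \<exists>L\<ge>0. k_connected d k X \<and>
       (\<forall>D\<ge>0. \<exists>Z\<in>\<Z>. \<exists>C\<^sub>1 C\<^sub>2. C\<^sub>1 \<noteq> C\<^sub>2 \<and>
          k_component d k (X - thickening X d Z L) C\<^sub>1 \<and>
          k_component d k (X - thickening X d Z L) C\<^sub>2 \<and>
          (\<exists>x\<in>C\<^sub>1. ereal D \<le> point_dist d x Z) \<and>
          (\<exists>x\<in>C\<^sub>2. ereal D \<le> point_dist d x Z)))"


section \<open>Growth of families of subsets\<close>

text \<open>The supremum is taken in \<^typ>\<open>nat\<close>: in a graph of bounded degree the cardinalities of the balls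
  of a given radius are finite and bounded. For a family without points the value is \<open>0\<close>, and
  since \<open>ln 0 = 0\<close> such a family has subexponential growth.\<close>
definition family_growth :: "'x set \<Rightarrow> ('x \<Rightarrow> 'x \<Rightarrow> real) \<Rightarrow> 'x set set \<Rightarrow> real \<Rightarrow> nat" where
  "family_growth X d \<S> R = Sup {card ({x \<in> X. d s x \<le> R} \<inter> S) | s S. S \<in> \<S> \<and> s \<in> S}"

definition exponential_growth :: "'x set \<Rightarrow> ('x \<Rightarrow> 'x \<Rightarrow> real) \<Rightarrow> 'x set set \<Rightarrow> bool" where
  "exponential_growth X d \<S> \<longleftrightarrow>
     0 < Limsup at_top (\<lambda>r::real. ereal (1 / r * ln (real (family_growth X d \<S> r))))"

abbreviation subexponential_growth :: "'x set \<Rightarrow> ('x \<Rightarrow> 'x \<Rightarrow> real) \<Rightarrow> 'x set set \<Rightarrow> bool" where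
  "subexponential_growth X d \<S> \<equiv> \<not> exponential_growth X d \<S>"


section \<open>Cayley graphs and coarse separability of groups\<close>

definition finite_generating_set :: "('g, 'b) monoid_scheme \<Rightarrow> 'g set \<Rightarrow> bool" where
  "finite_generating_set G S \<longleftrightarrow> finite S \<and> S \<subseteq> carrier G \<and> generate G S = carrier G"

definition finitely_generated :: "('g, 'b) monoid_scheme \<Rightarrow> bool" where
  "finitely_generated G \<longleftrightarrow> (\<exists>S. finite_generating_set G S)"

text \<open>The edges of the Cayley graph, whose vertex set is \<open>carrier G\<close>. Since edges are
  unordered pairs, there is no need to assume that \<open>S\<close> is symmetric; loops are left out.\<close>
definition cayley_edges :: "('g, 'b) monoid_scheme \<Rightarrow> 'g set \<Rightarrow> 'g set set" where
  "cayley_edges G S = {{g, g \<otimes>\<^bsub>G\<^esub> s} | g s. g \<in> carrier G \<and> s \<in> S \<and> g \<otimes>\<^bsub>G\<^esub> s \<noteq> g}"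

definition cayley_dist :: "('g, 'b) monoid_scheme \<Rightarrow> 'g set \<Rightarrow> 'g \<Rightarrow> 'g \<Rightarrow> real" where
  "cayley_dist G S x y = real (graph_dist (cayley_edges G S) x y)"

definition subexp_coarsely_separable :: "('g, 'b) monoid_scheme \<Rightarrow> bool" where
  "subexp_coarsely_separable G \<longleftrightarrow>
     (\<exists>S \<Z>. finite_generating_set G S \<and>
        coarsely_separated (carrier G) (cayley_dist G S) \<Z> \<and>
        subexponential_growth (carrier G) (cayley_dist G S) \<Z>)"

end

theory Submission
  imports Defs "HOL-Algebra.Bij"
begin

text \<open>
  Let \<open>P\<close> be the graph product of the groups \<open>G u\<close>, and let \<open>Q\<close> be the graph product of the cyclic
  groups of one large order \<open>n\<close>. The idea is that \<open>P\<close> is covered by uniformly controlled copies of \<open>Q\<close>,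
  neighbouring copies meeting in sets of exponential growth, which sets of subexponential growth are
  unable to cut apart.

  In every factor \<open>G u\<close> choose a window: \<open>n\<close> elements, among them the identity, a finite generating
  set and the inverses of the generators. Label the window by the cyclic group of order \<open>n\<close>. These
  labellings are mere maps, but maps between the factors still induce maps between the graph products
  (\<open>gp_cocycle_exists\<close>): read a word from left to right, remember the value \<open>r\<close> that the retraction to
  \<open>G u\<close> takes on the part already read, and translate the next letter \<open>g\<close> of \<open>G u\<close> into
  \<open>f(r)\<^sup>-\<^sup>1 f(r g)\<close>. The construction is compatible with composition, so left inverses on the factors
  give left inverses on the products (\<open>gp_lifts_left_inverse\<close>), and the labellings yield an injective
  Lipschitz map \<open>\<phi>\<close> from \<open>Q\<close> to \<open>P\<close>. Its image consists of the elements that can be reached by words all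
  of whose retracted prefixes stay in the windows (\<open>gp_lifts_image_step\<close>).

  The left translates of \<open>\<phi>\<close> cover \<open>P\<close>. Let \<open>s \<noteq> 1\<close> be a chosen generator of \<open>G u\<close>. Because the graph is not
  a join and has a second vertex, some vertex \<open>v\<close> is not adjacent to \<open>u\<close>. Words that move between the
  states \<open>1, s\<close> in \<open>G u\<close> and between three states in \<open>G v\<close> stay in the windows, before and after
  multiplication by \<open>s\<^sup>-\<^sup>1\<close> from the left. They imitate the free product of the cyclic groups of orders
  2 and 3, so the copies \<open>p \<phi>(Q)\<close> and \<open>p s \<phi>(Q)\<close> share a set of exponential growth
  (\<open>overlap_translate\<close>). Since the generators generate, any two copies are linked by a chain of such
  overlaps (\<open>copies_linked\<close>).

  Now let a family of subexponential growth separate \<open>P\<close>. The preimages of thickenings of its members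
  under the translates of \<open>\<phi>\<close> form a family of subexponential growth in \<open>Q\<close>. If it did not separate \<open>Q\<close>,
  then in each copy all points far from a member \<open>Z\<close> would lie in one coarse component of the complement
  of \<open>Z\<close>. Overlaps are too large to stay near \<open>Z\<close>, so linked copies would lie in the same component, and
  \<open>Z\<close> would not separate \<open>P\<close> after all (\<open>coarse_separation_transfer\<close>).
\<close>

section \<open>Cayley graphs as metric spaces\<close>

locale cayley_graph = group G for G (structure) +
  fixes S assumes gen: "finite_generating_set G S"
begin

definition edge :: "('a \<times> 'a) set" where
  "edge = {(a, b). {a, b} \<in> cayley_edges G S}"

abbreviation cdist :: "'a \<Rightarrow> 'a \<Rightarrow> real" where
  "cdist \<equiv> cayley_dist G S"

lemma generators: "finite S" "S \<subseteq> carrier G" "generate G S = carrier G"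
  using gen by (auto simp: finite_generating_set_def)

lemma edge_iff:
  "(a, b) \<in> edge \<longleftrightarrow> a \<in> carrier G \<and> b \<in> carrier G \<and> a \<noteq> b \<and> (\<exists>s\<in>S. b = a \<otimes> s \<or> a = b \<otimes> s)"
proof
  assume "(a, b) \<in> edge"
  then obtain g s where g: "{a, b} = {g, g \<otimes> s}" "g \<in> carrier G" "s \<in> S" "g \<otimes> s \<noteq> g"
    by (auto simp: cayley_edges_def edge_def)
  then have "g \<otimes> s \<in> carrier G" using generators(2) by auto
  with g show "a \<in> carrier G \<and> b \<in> carrier G \<and> a \<noteq> b \<and> (\<exists>s\<in>S. b = a \<otimes> s \<or> a = b \<otimes> s)"
    by (auto simp: doubleton_eq_iff)
next
  assume ab: "a \<in> carrier G \<and> b \<in> carrier G \<and> a \<noteq> b \<and> (\<exists>s\<in>S. b = a \<otimes> s \<or> a = b \<otimes> s)"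
  then obtain s where s: "s \<in> S" "b = a \<otimes> s \<or> a = b \<otimes> s" by blast
  have mem: "{g, g \<otimes> s} \<in> cayley_edges G S" if "g \<in> carrier G" "g \<otimes> s \<noteq> g" for g
    using that s(1) by (auto simp: cayley_edges_def)
  have "{a, b} \<in> cayley_edges G S"
    using s(2) mem[of a] mem[of b] ab by (metis insert_commute)
  then show "(a, b) \<in> edge" by (simp add: edge_def)
qed

lemma sym_edge: "sym edge"
  by (auto simp: sym_def edge_iff)

lemma edge_pow_closed: "(x, y) \<in> edge ^^ n \<Longrightarrow> x \<in> carrier G \<Longrightarrow> y \<in> carrier G"
  by (cases n) (auto simp: edge_iff)

lemma edge_pow_translate:
  assumes "(x, y) \<in> edge ^^ n" "g \<in> carrier G" "x \<in> carrier G"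
  shows "(g \<otimes> x, g \<otimes> y) \<in> edge ^^ n"
  using assms(1)
proof (induction n arbitrary: y)
  case 0
  then show ?case by simp
next
  case (Suc n)
  then obtain z where z: "(x, z) \<in> edge ^^ n" "(z, y) \<in> edge" by auto
  have "(g \<otimes> z, g \<otimes> y) \<in> edge"
    using z(2) assms(2) generators(2) unfolding edge_iff by (auto simp: m_assoc subset_iff)
  then show ?case using Suc.IH[OF z(1)] by auto
qed

lemma edge_or_eq:
  assumes "x \<in> carrier G" "s \<in> S"
  shows "(x, x \<otimes> s) \<in> edge\<^sup>*"
proof (cases "x \<otimes> s = x")
  case False
  then have "(x, x \<otimes> s) \<in> edge" using assms generators(2) by (auto simp: edge_iff)
  then show ?thesis by (rule r_into_rtrancl)
qed simp

lemma connected: 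
  assumes "x \<in> carrier G" "y \<in> carrier G"
  shows "(x, y) \<in> edge\<^sup>*"
proof -
  have gc: "h \<in> carrier G" if "h \<in> generate G S" for h using that generators(3) by simp
  have "(x, x \<otimes> h) \<in> edge\<^sup>*" if "h \<in> generate G S" "x \<in> carrier G" for h x
    using that
  proof (induction arbitrary: x)
    case (inv h)
    have h: "h \<in> carrier G" using inv.hyps generators(2) by auto
    have "(x \<otimes> inv h, x \<otimes> inv h \<otimes> h) \<in> edge\<^sup>*"
      by (rule edge_or_eq) (use inv h in auto)
    moreover have "x \<otimes> inv h \<otimes> h = x" using inv.prems h by (simp add: m_assoc)
    ultimately have "(x \<otimes> inv h, x) \<in> edge\<^sup>*" by simp
    then show ?case by (rule symD[OF sym_rtrancl[OF sym_edge]])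
  next
    case (eng h1 h2)
    have c: "h1 \<in> carrier G" "h2 \<in> carrier G" by (rule gc[OF eng.hyps(1)], rule gc[OF eng.hyps(2)])
    have "(x, x \<otimes> h1) \<in> edge\<^sup>*" by (rule eng.IH(1)[OF eng.prems])
    moreover have "(x \<otimes> h1, x \<otimes> h1 \<otimes> h2) \<in> edge\<^sup>*"
      by (rule eng.IH(2)) (use eng.prems c in simp)
    ultimately have "(x, x \<otimes> h1 \<otimes> h2) \<in> edge\<^sup>*" by (rule rtrancl_trans)
    then show ?case using eng.prems c by (simp add: m_assoc)
  qed (auto simp: edge_or_eq)
  from this[of "inv x \<otimes> y" x] assms show ?thesis
    using generators(3) by (simp add: m_assoc[symmetric])
qed

lemma cdist_le: "(x, y) \<in> edge ^^ n \<Longrightarrow> cdist x y \<le> real n"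
  by (simp add: cayley_dist_def graph_dist_def edge_def Least_le)

lemma cdist_attained:
  assumes "x \<in> carrier G" "y \<in> carrier G"
  obtains n where "(x, y) \<in> edge ^^ n" "cdist x y = real n"
proof -
  obtain n where "(x, y) \<in> edge ^^ n"
    using connected[OF assms] by (auto dest: rtrancl_imp_relpow)
  then have "(x, y) \<in> edge ^^ (LEAST n. (x, y) \<in> edge ^^ n)" by (rule LeastI)
  then show ?thesis by (intro that) (auto simp: cayley_dist_def graph_dist_def edge_def)
qed

lemma cdist_nonneg: "0 \<le> cdist x y"
  by (simp add: cayley_dist_def)

lemma cdist_self [simp]: "cdist x x = 0"
  using cdist_le[of x x 0] cdist_nonneg[of x x] by simp

lemma cdist_less_one:
  assumes "x \<in> carrier G" "y \<in> carrier G" "cdist x y < 1"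
  shows "x = y"
  using cdist_attained[OF assms(1,2)] assms(3) by (metis less_one of_nat_less_1_iff pair_in_Id_conv relpow.simps(1))

lemma cdist_sym: "cdist x y = cdist y x"
proof -
  have "(b, a) \<in> edge ^^ n" if "(a, b) \<in> edge ^^ n" for a b n
    using that
  proof (induction n arbitrary: b)
    case (Suc n)
    then obtain c where "(a, c) \<in> edge ^^ n" "(c, b) \<in> edge" by auto
    with Suc.IH symD[OF sym_edge] show ?case by (blast intro: relpow_Suc_I2)
  qed simp
  then have "(x, y) \<in> edge ^^ n \<longleftrightarrow> (y, x) \<in> edge ^^ n" for n by blast
  then show ?thesis by (simp add: cayley_dist_def graph_dist_def edge_def)
qed

lemma cdist_triangle:
  assumes "x \<in> carrier G" "y \<in> carrier G" "z \<in> carrier G"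
  shows "cdist x z \<le> cdist x y + cdist y z"
proof -
  obtain m where m: "(x, y) \<in> edge ^^ m" "cdist x y = real m" using cdist_attained assms by blast
  obtain n where n: "(y, z) \<in> edge ^^ n" "cdist y z = real n" using cdist_attained assms by blast
  have "(x, z) \<in> edge ^^ (m + n)" using m n by (auto simp: relpow_add)
  then show ?thesis using cdist_le m n by force
qed

lemma cdist_translate:
  assumes "g \<in> carrier G" "x \<in> carrier G" "y \<in> carrier G"
  shows "cdist (g \<otimes> x) (g \<otimes> y) = cdist x y"
proof -
  have "(g \<otimes> x, g \<otimes> y) \<in> edge ^^ n \<longleftrightarrow> (x, y) \<in> edge ^^ n" for n
    using edge_pow_translate[of x y n g] edge_pow_translate[of "g \<otimes> x" "g \<otimes> y" n "inv g"] assms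
    by (auto simp: m_assoc[symmetric])
  then show ?thesis by (simp add: cayley_dist_def graph_dist_def edge_def)
qed

lemma cdist_generator: "x \<in> carrier G \<Longrightarrow> s \<in> S \<Longrightarrow> cdist x (x \<otimes> s) \<le> 1"
  using cdist_le[of x "x \<otimes> s" 1] generators(2)
  by (cases "x \<otimes> s = x") (auto simp: edge_iff)

lemma finite_cball:
  assumes "x \<in> carrier G"
  shows "finite {y \<in> carrier G. cdist x y \<le> R}"
proof -
  have fin: "finite {y. (x, y) \<in> edge ^^ n}" for n
  proof (induction n)
    case (Suc n)
    have "{y. (x, y) \<in> edge ^^ Suc n} \<subseteq>
      (\<Union>z\<in>{z. (x, z) \<in> edge ^^ n}. (\<lambda>s. z \<otimes> s) ` S \<union> (\<lambda>s. z \<otimes> inv s) ` S)"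
    proof
      fix y assume "y \<in> {y. (x, y) \<in> edge ^^ Suc n}"
      then obtain z where z: "(x, z) \<in> edge ^^ n" "(z, y) \<in> edge" by auto
      from z(2) obtain s where "s \<in> S" "y = z \<otimes> s \<or> z = y \<otimes> s" "y \<in> carrier G" "z \<in> carrier G"
        by (auto simp: edge_iff)
      then have "y = z \<otimes> s \<or> y = z \<otimes> inv s" "s \<in> S"
        using generators(2) by (auto simp: m_assoc subset_iff)
      with z(1) show "y \<in> (\<Union>z\<in>{z. (x, z) \<in> edge ^^ n}. (\<lambda>s. z \<otimes> s) ` S \<union> (\<lambda>s. z \<otimes> inv s) ` S)"
        by blast
    qed
    then show ?case by (rule finite_subset) (use Suc generators(1) in auto)
  qed simp
  have "{y \<in> carrier G. cdist x y \<le> R} \<subseteq> (\<Union>n\<in>{n. real n \<le> R}. {y. (x, y) \<in> edge ^^ n})"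
    by (auto elim!: cdist_attained[OF assms]) 
  moreover have "finite {n. real n \<le> R}"
    by (rule finite_subset[of _ "{..nat \<lfloor>R\<rfloor>}"]) (auto simp: le_nat_floor)
  ultimately show ?thesis using fin by (meson finite_UN finite_subset)
qed

lemma card_cball:
  assumes "x \<in> carrier G"
  shows "card {y \<in> carrier G. cdist x y \<le> R} = card {y \<in> carrier G. cdist \<one> y \<le> R}"
proof -
  have "bij_betw (\<lambda>y. x \<otimes> y) {y \<in> carrier G. cdist \<one> y \<le> R} {y \<in> carrier G. cdist x y \<le> R}"
  proof (rule bij_betwI[of _ _ _ "\<lambda>y. inv x \<otimes> y"])
    show "(\<otimes>) x \<in> {y \<in> carrier G. cdist \<one> y \<le> R} \<rightarrow> {y \<in> carrier G. cdist x y \<le> R}"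
      using assms cdist_translate[of x \<one>] by auto
    show "(\<otimes>) (inv x) \<in> {y \<in> carrier G. cdist x y \<le> R} \<rightarrow> {y \<in> carrier G. cdist \<one> y \<le> R}"
      using assms cdist_translate[of "inv x" x] by auto
  qed (use assms in \<open>auto simp: m_assoc[symmetric]\<close>)
  then show ?thesis by (simp add: bij_betw_same_card)
qed

text \<open>A shortest path does not leave the ball about its first point through its last point.\<close>
lemma chain_near:
  assumes "x \<in> carrier G" "y \<in> carrier G"
    and "\<And>q. q \<in> carrier G \<Longrightarrow> cdist x q \<le> cdist x y \<Longrightarrow> q \<in> A"
  shows "(x, y) \<in> {(a, b). a \<in> A \<and> b \<in> A \<and> cdist a b \<le> 1}\<^sup>*"
proof -
  obtain n where n: "(x, y) \<in> edge ^^ n" "cdist x y = real n" using cdist_attained assms by blast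
  have "(x, z) \<in> {(a, b). a \<in> A \<and> b \<in> A \<and> cdist a b \<le> 1}\<^sup>*"
    if "(x, z) \<in> edge ^^ m" "m \<le> n" for z m
    using that
  proof (induction m arbitrary: z)
    case (Suc m)
    then obtain w where w: "(x, w) \<in> edge ^^ m" "(w, z) \<in> edge" by auto
    have "w \<in> A" "z \<in> A"
      using cdist_le[OF w(1)] cdist_le[OF Suc.prems(1)] Suc.prems(2) n(2)
        edge_pow_closed[OF w(1) assms(1)] edge_pow_closed[OF Suc.prems(1) assms(1)]
      by (auto intro!: assms(3))
    moreover have "cdist w z \<le> 1" using cdist_le[of w z 1] w(2) by auto
    ultimately have "(w, z) \<in> {(a, b). a \<in> A \<and> b \<in> A \<and> cdist a b \<le> 1}" by auto
    then show ?case using Suc.IH[OF w(1)] Suc.prems(2) by (meson Suc_leD rtrancl.rtrancl_into_rtrancl)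
  qed auto
  with n(1) show ?thesis by blast
qed

lemma lipschitz_from_generators:
  assumes tri: "\<And>x y z. x \<in> Y \<Longrightarrow> y \<in> Y \<Longrightarrow> z \<in> Y \<Longrightarrow> d x z \<le> d x y + d y z"
    and sym: "\<And>x y. d x y = d y x" and refl: "\<And>x. d x x = (0::real)"
    and f: "f \<in> carrier G \<rightarrow> Y"
    and gen: "\<And>x s. x \<in> carrier G \<Longrightarrow> s \<in> S \<Longrightarrow> d (f x) (f (x \<otimes> s)) \<le> A"
    and x: "x \<in> carrier G" "y \<in> carrier G"
  shows "d (f x) (f y) \<le> A * cdist x y"
proof -
  obtain n where n: "(x, y) \<in> edge ^^ n" "cdist x y = real n" using cdist_attained x by blast
  have "d (f x) (f z) \<le> A * real m" if "(x, z) \<in> edge ^^ m" for z m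
    using that
  proof (induction m arbitrary: z)
    case (Suc m)
    then obtain w where w: "(x, w) \<in> edge ^^ m" "(w, z) \<in> edge" by auto
    have c: "w \<in> carrier G" "z \<in> carrier G"
      using edge_pow_closed[OF w(1) x(1)] edge_pow_closed[OF Suc.prems x(1)] .
    have "d (f w) (f z) \<le> A"
    proof -
      obtain s where s: "s \<in> S" "z = w \<otimes> s \<or> w = z \<otimes> s" using w(2) unfolding edge_iff by blast
      from s(2) show ?thesis
      proof
        assume "w = z \<otimes> s"
        then show ?thesis using gen[OF c(2) s(1)] sym[of "f w" "f z"] by simp
      qed (use gen[OF c(1) s(1)] in simp)
    qed
    moreover have "d (f x) (f z) \<le> d (f x) (f w) + d (f w) (f z)"
      using f x c by (auto intro!: tri)
    ultimately show ?case using Suc.IH[OF w(1)] by (simp add: algebra_simps)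
  qed (auto simp: refl)
  with n show ?thesis by auto
qed

end

section \<open>Subexponential growth\<close>

context cayley_graph begin

definition near :: "'a set \<Rightarrow> real \<Rightarrow> 'a \<Rightarrow> bool" where
  "near Z r x \<longleftrightarrow> (\<exists>z\<in>Z. cdist x z \<le> r)"

lemma card_ball_le_growth:
  assumes "\<Union>\<Z> \<subseteq> carrier G" "Z \<in> \<Z>" "z \<in> Z"
  shows "card ({x \<in> carrier G. cdist z x \<le> R} \<inter> Z) \<le> family_growth (carrier G) cdist \<Z> R"
  unfolding family_growth_def
proof (rule cSup_upper)
  let ?b = "card {y \<in> carrier G. cdist \<one> y \<le> R}"
  have "card ({x \<in> carrier G. cdist s x \<le> R} \<inter> S) \<le> ?b" if "S \<in> \<Z>" "s \<in> S" for s S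
  proof -
    have s: "s \<in> carrier G" using that assms(1) by auto
    have "card ({x \<in> carrier G. cdist s x \<le> R} \<inter> S) \<le> card {x \<in> carrier G. cdist s x \<le> R}"
      by (rule card_mono) (use finite_cball[OF s] in auto)
    with card_cball[OF s] show ?thesis by simp
  qed
  then show "bdd_above {card ({x \<in> carrier G. cdist s x \<le> R} \<inter> S) | s S. S \<in> \<Z> \<and> s \<in> S}"
    by (auto simp: bdd_above_def)
qed (use assms in auto)

text \<open>The definition of the growth type involves only the supremum over the family. What is used of it is
  a bound on all balls at once, uniform over the members of the family.\<close>
lemma subexponential_growthD:
  assumes "subexponential_growth (carrier G) cdist \<Z>" "\<Union>\<Z> \<subseteq> carrier G" "\<epsilon> > 0"
  shows "\<forall>\<^sub>F R in at_top. \<forall>Z\<in>\<Z>. \<forall>z\<in>Z. real (card ({x \<in> carrier G. cdist z x \<le> R} \<inter> Z)) \<le> exp (\<epsilon> * R)"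
proof -
  let ?V = "family_growth (carrier G) cdist \<Z>"
  have "Limsup at_top (\<lambda>r::real. ereal (1 / r * ln (real (?V r)))) < ereal \<epsilon>"
    using assms(1,3) unfolding exponential_growth_def by (simp add: not_less le_less_trans)
  then have "\<forall>\<^sub>F r in at_top. ereal (1 / r * ln (real (?V r))) < ereal \<epsilon>"
    by (rule Limsup_lessD)
  then show ?thesis
    using eventually_gt_at_top[of 0]
  proof eventually_elim
    case (elim r)
    then have le: "ln (real (?V r)) \<le> \<epsilon> * r" by (simp add: field_simps)
    show ?case
    proof (intro ballI)
      fix Z z assume Z: "Z \<in> \<Z>" "z \<in> Z"
      have zc: "z \<in> carrier G" using Z assms(2) by auto
      have "z \<in> {x \<in> carrier G. cdist z x \<le> r} \<inter> Z" using Z zc elim by auto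
      then have "0 < card ({x \<in> carrier G. cdist z x \<le> r} \<inter> Z)"
        using finite_cball[OF zc, of r] by (auto simp: card_gt_0_iff)
      moreover have up: "card ({x \<in> carrier G. cdist z x \<le> r} \<inter> Z) \<le> ?V r"
        using card_ball_le_growth[of \<Z> Z z] assms(2) Z by blast
      ultimately have "0 < real (?V r)" by simp
      then have "real (?V r) \<le> exp (\<epsilon> * r)" using le by (metis exp_le_cancel_iff exp_ln)
      with up show "real (card ({x \<in> carrier G. cdist z x \<le> r} \<inter> Z)) \<le> exp (\<epsilon> * r)" by linarith
    qed
  qed
qed

lemma subexponential_growthI:
  assumes "\<And>\<epsilon>. \<epsilon> > 0 \<Longrightarrow> \<forall>\<^sub>F R in at_top. \<forall>Z\<in>\<Z>. \<forall>z\<in>Z.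
      real (card ({x \<in> carrier G. cdist z x \<le> R} \<inter> Z)) \<le> exp (\<epsilon> * R)"
  shows "subexponential_growth (carrier G) cdist \<Z>"
proof -
  let ?V = "family_growth (carrier G) cdist \<Z>"
  have le: "Limsup at_top (\<lambda>r::real. ereal (1 / r * ln (real (?V r)))) \<le> ereal \<epsilon>" if e: "\<epsilon> > 0" for \<epsilon>
  proof (rule Limsup_bounded)
    show "\<forall>\<^sub>F r in at_top. ereal (1 / r * ln (real (?V r))) \<le> ereal \<epsilon>"
      using assms[OF e] eventually_gt_at_top[of 0]
    proof eventually_elim
      case (elim r)
      let ?C = "{card ({x \<in> carrier G. cdist z x \<le> r} \<inter> Z) | z Z. Z \<in> \<Z> \<and> z \<in> Z}"
      have V: "real (?V r) \<le> exp (\<epsilon> * r)"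
      proof (cases "?C = {}")
        case True
        then show ?thesis unfolding family_growth_def by (subst True) simp
      next
        case False
        have bound: "n \<le> nat \<lfloor>exp (\<epsilon> * r)\<rfloor>" if "n \<in> ?C" for n
          using that elim by (auto simp: le_nat_floor)
        have "?V r \<le> nat \<lfloor>exp (\<epsilon> * r)\<rfloor>"
          unfolding family_growth_def using False bound by (rule cSup_least)
        then show ?thesis using of_nat_floor[OF exp_ge_zero, of "\<epsilon> * r"] by linarith
      qed
      have "ln (real (?V r)) \<le> \<epsilon> * r"
      proof (cases "?V r = 0")
        case False
        then show ?thesis using V by (metis ln_exp ln_mono of_nat_0_less_iff neq0_conv)
      qed (use e elim in simp)
      then show ?case using elim by (simp add: field_simps)
    qed
  qed
  show ?thesis
  proof
    assume "exponential_growth (carrier G) cdist \<Z>"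
    then have "0 < Limsup at_top (\<lambda>r::real. ereal (1 / r * ln (real (?V r))))"
      unfolding exponential_growth_def .
    then obtain e where e: "0 < ereal e" "ereal e < Limsup at_top (\<lambda>r::real. ereal (1 / r * ln (real (?V r))))"
      by (rule ereal_dense2[THEN exE]) blast
    then show False using le[of e] by (simp add: not_le[symmetric])
  qed
qed

text \<open>The points near \<open>Z\<close> are covered by balls of one radius about points of \<open>Z\<close>, and by homogeneity these
  balls all have the same number of points.\<close>
lemma card_near_le:
  assumes Z: "Z \<subseteq> carrier G" and q: "q \<in> carrier G" "near Z m q" 
  obtains z where "z \<in> Z" 
    "card {x \<in> carrier G. cdist q x \<le> R \<and> near Z m x} \<le>
     card ({x \<in> carrier G. cdist z x \<le> R + 2 * m} \<inter> Z) * card {x \<in> carrier G. cdist \<one> x \<le> m}"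
proof -
  obtain z where z: "z \<in> Z" "cdist q z \<le> m" using q by (auto simp: near_def)
  have zc: "z \<in> carrier G" using z Z by auto
  let ?B = "{x \<in> carrier G. cdist z x \<le> R + 2 * m} \<inter> Z"
  have fB: "finite ?B" using finite_cball[OF zc] by auto
  have sub: "{x \<in> carrier G. cdist q x \<le> R \<and> near Z m x} \<subseteq> (\<Union>y\<in>?B. {x \<in> carrier G. cdist y x \<le> m})"
  proof
    fix x assume "x \<in> {x \<in> carrier G. cdist q x \<le> R \<and> near Z m x}"
    then obtain y where x: "x \<in> carrier G" "cdist q x \<le> R" "y \<in> Z" "cdist x y \<le> m"
      by (auto simp: near_def)
    have yc: "y \<in> carrier G" using x Z by auto
    have "cdist z y \<le> R + 2 * m"
      using cdist_triangle[OF zc q(1) yc] cdist_triangle[OF q(1) x(1) yc] x z by (simp add: cdist_sym)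
    then show "x \<in> (\<Union>y\<in>?B. {x \<in> carrier G. cdist y x \<le> m})"
      using x yc by (auto simp: cdist_sym)
  qed
  have "card {x \<in> carrier G. cdist q x \<le> R \<and> near Z m x} \<le> card (\<Union>y\<in>?B. {x \<in> carrier G. cdist y x \<le> m})"
    by (rule card_mono[OF _ sub]) (use fB finite_cball in auto)
  also have "\<dots> \<le> (\<Sum>y\<in>?B. card {x \<in> carrier G. cdist y x \<le> m})"
    by (rule card_UN_le[OF fB])
  also have "\<dots> = (\<Sum>y\<in>?B. card {x \<in> carrier G. cdist \<one> x \<le> m})"
    by (rule sum.cong) (auto intro!: card_cball)
  finally show ?thesis using z(1) that by simp
qed

text \<open>Thickening multiplies the number of points in a ball by at most a constant and enlarges the radius by
  a constant; together with a linear change of the radius this does not affect subexponential growth.\<close>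
lemma subexponential_growth_near:
  assumes "subexponential_growth (carrier G) cdist \<Z>" "\<Union>\<Z> \<subseteq> carrier G"
    and a: "a > 0" and \<epsilon>: "\<epsilon> > 0"
  shows "\<forall>\<^sub>F R in at_top. \<forall>Z\<in>\<Z>. \<forall>q\<in>carrier G. near Z m q \<longrightarrow>
      real (card {x \<in> carrier G. cdist q x \<le> a * R \<and> near Z m x}) \<le> exp (\<epsilon> * R)"
proof -
  define c where "c = real (card {x \<in> carrier G. cdist \<one> x \<le> m})"
  define e where "e = \<epsilon> / (2 * a)"
  have e: "e > 0" using a \<epsilon> by (simp add: e_def)
  have lim: "filterlim (\<lambda>R. a * R + 2 * m) at_top at_top"
  proof -
    have "filterlim (\<lambda>R. 2 * m + a * R) at_top at_top"
      by (intro filterlim_tendsto_add_at_top[OF tendsto_const]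
          filterlim_tendsto_pos_mult_at_top[OF tendsto_const a] filterlim_ident)
    then show ?thesis by (simp add: add.commute)
  qed
  have "\<forall>\<^sub>F R in at_top. c * exp (2 * e * m) \<le> exp (\<epsilon> / 2 * R)"
  proof -
    have "filterlim (\<lambda>R. exp (\<epsilon> / 2 * R)) at_top at_top"
      using \<epsilon> by (intro filterlim_compose[OF exp_at_top] filterlim_tendsto_pos_mult_at_top[OF tendsto_const] filterlim_ident) auto
    then show ?thesis by (simp add: filterlim_at_top)
  qed
  moreover have "\<forall>\<^sub>F R in at_top. \<forall>Z\<in>\<Z>. \<forall>z\<in>Z.
      real (card ({x \<in> carrier G. cdist z x \<le> a * R + 2 * m} \<inter> Z)) \<le> exp (e * (a * R + 2 * m))"
    by (rule eventually_compose_filterlim[OF subexponential_growthD[OF assms(1,2) e] lim])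
  ultimately show ?thesis
  proof eventually_elim
    case (elim R)
    show ?case
    proof (intro ballI impI)
      fix Z q assume Z: "Z \<in> \<Z>" and q: "q \<in> carrier G" "near Z m q"
      have Zc: "Z \<subseteq> carrier G" using Z assms(2) by blast
      obtain z where z: "z \<in> Z" and le: "card {x \<in> carrier G. cdist q x \<le> a * R \<and> near Z m x} \<le>
        card ({x \<in> carrier G. cdist z x \<le> a * R + 2 * m} \<inter> Z) * card {x \<in> carrier G. cdist \<one> x \<le> m}"
        using card_near_le[OF Zc q] by blast
      have "real (card {x \<in> carrier G. cdist q x \<le> a * R \<and> near Z m x})
          \<le> real (card ({x \<in> carrier G. cdist z x \<le> a * R + 2 * m} \<inter> Z)) * c"
        using of_nat_mono[OF le, where 'a=real] unfolding c_def of_nat_mult .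
      also have "\<dots> \<le> exp (e * (a * R + 2 * m)) * c"
        using elim(2) Z z by (intro mult_right_mono) (auto simp: c_def)
      also have "\<dots> = (c * exp (2 * e * m)) * exp (\<epsilon> / 2 * R)"
        using a by (simp add: e_def exp_add[symmetric] field_simps)
      also have "\<dots> \<le> exp (\<epsilon> / 2 * R) * exp (\<epsilon> / 2 * R)"
        using elim(1) by (intro mult_right_mono) auto
      also have "\<dots> = exp (\<epsilon> * R)" by (simp add: exp_add[symmetric])
      finally show "real (card {x \<in> carrier G. cdist q x \<le> a * R \<and> near Z m x}) \<le> exp (\<epsilon> * R)" .
    qed
  qed
qed

end

section \<open>Transfer of coarse separation along overlapping copies\<close>

abbreviation chain_rel :: "('x \<Rightarrow> 'x \<Rightarrow> real) \<Rightarrow> real \<Rightarrow> 'x set \<Rightarrow> ('x \<times> 'x) set" where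
  "chain_rel d k A \<equiv> {(a, b). a \<in> A \<and> b \<in> A \<and> d a b \<le> k}"

lemma sym_chain:
  assumes "\<And>x y. d x y = d y x"
  shows "sym ((chain_rel d k A)\<^sup>*)"
  by (rule sym_rtrancl) (auto simp: sym_def assms)

lemma chain_closed: "(x, y) \<in> (chain_rel d k A)\<^sup>* \<Longrightarrow> x \<in> A \<Longrightarrow> y \<in> A"
  by (induction rule: rtrancl_induct) auto

lemma k_connected_chain_class:
  assumes sym: "\<And>x y. d x y = d y x"
  shows "k_connected d k {y. (x, y) \<in> (chain_rel d k A)\<^sup>*}" (is "k_connected d k ?D")
proof -
  have "(x, y) \<in> (chain_rel d k ?D)\<^sup>*" if "(x, y) \<in> (chain_rel d k A)\<^sup>*" for y
    using that
  proof (induction rule: rtrancl_induct)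
    case (step y z)
    have "(x, z) \<in> (chain_rel d k A)\<^sup>*" using step(1,2) by (rule rtrancl.rtrancl_into_rtrancl)
    with step have "(y, z) \<in> chain_rel d k ?D" by auto
    then show ?case by (rule rtrancl.rtrancl_into_rtrancl[OF step.IH])
  qed simp
  note reach = this
  show ?thesis
    unfolding k_connected_def
  proof (intro ballI)
    fix y z assume "y \<in> ?D" "z \<in> ?D"
    then have yz: "(x, y) \<in> (chain_rel d k ?D)\<^sup>*" "(x, z) \<in> (chain_rel d k ?D)\<^sup>*"
      using reach by simp_all
    from yz(1) have "(y, x) \<in> (chain_rel d k ?D)\<^sup>*" by (rule symD[OF sym_chain[OF sym]])
    then show "(y, z) \<in> (chain_rel d k ?D)\<^sup>*" using yz(2) by (rule rtrancl_trans)
  qed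
qed

text \<open>Together with the next lemma: the \<open>k\<close>-components are the classes of points joined by \<open>k\<close>-chains.
  This turns statements about maximal subsets into statements about reachability.\<close>
lemma k_component_chain_class:
  assumes sym: "\<And>x y. d x y = d y x" and x: "x \<in> A"
  shows "k_component d k A {y. (x, y) \<in> (chain_rel d k A)\<^sup>*}" (is "k_component d k A ?D")
  unfolding k_component_def
proof (intro conjI allI impI)
  show "?D \<subseteq> A" by (rule subsetI, rule chain_closed[OF _ x]) simp
  show "k_connected d k ?D" by (rule k_connected_chain_class[OF sym])
  fix C' assume C': "?D \<subseteq> C' \<and> C' \<subseteq> A \<and> k_connected d k C'"
  have "x \<in> C'" using C' by auto
  have "(chain_rel d k C')\<^sup>* \<subseteq> (chain_rel d k A)\<^sup>*"
    by (rule rtrancl_mono) (use C' in auto)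
  then have "C' \<subseteq> ?D" using C' \<open>x \<in> C'\<close> unfolding k_connected_def by blast
  then show "C' = ?D" using C' by blast
qed

lemma k_component_eq_chain_class:
  assumes sym: "\<And>x y. d x y = d y x" and C: "k_component d k A C" "x \<in> C"
  shows "C = {y. (x, y) \<in> (chain_rel d k A)\<^sup>*}" (is "C = ?D")
proof -
  have x: "x \<in> A" using C by (auto simp: k_component_def)
  have D: "k_component d k A ?D" by (rule k_component_chain_class[OF sym x])
  have "(chain_rel d k C)\<^sup>* \<subseteq> (chain_rel d k A)\<^sup>*"
    by (rule rtrancl_mono) (use C in \<open>auto simp: k_component_def\<close>)
  then have "C \<subseteq> ?D" using C unfolding k_component_def k_connected_def by blast
  with C D show ?thesis unfolding k_component_def by blast
qed

context cayley_graph begin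

lemmas component_chain_class = k_component_chain_class[where d = cdist, OF cdist_sym]
lemmas component_eq_chain_class = k_component_eq_chain_class[where d = cdist, OF cdist_sym]

text \<open>Membership in a thickening is defined by an infimum. The margin \<open>1\<close> makes it possible to work with
  witnesses \<open>z \<in> Z\<close> throughout.\<close>
lemma not_in_thickening:
  assumes "\<not> near Z (L + 1) q"
  shows "q \<notin> thickening X cdist Z L"
proof
  assume "q \<in> thickening X cdist Z L"
  then have "(INF z\<in>Z. ereal (cdist q z)) < ereal (L + 1)"
    by (auto simp: thickening_def point_dist_def intro: le_less_trans)
  then obtain z where "z \<in> Z" "cdist q z < L + 1" by (auto simp: INF_less_iff)
  with assms show False by (force simp: near_def)
qed

lemma not_near_of_far:
  assumes "ereal D \<le> point_dist cdist x Z" "r < D"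
  shows "\<not> near Z r x"
proof
  assume "near Z r x"
  then obtain z where z: "z \<in> Z" "cdist x z \<le> r" by (auto simp: near_def)
  have "point_dist cdist x Z \<le> ereal (cdist x z)"
    unfolding point_dist_def by (rule INF_lower[OF z(1)])
  with assms(1) have "ereal D \<le> ereal (cdist x z)" by (rule order_trans)
  with assms z show False by simp
qed

lemma k_connected_carrier: "k_connected cdist 1 (carrier G)"
  unfolding k_connected_def by (auto intro!: chain_near)

lemma near_translate:
  assumes "near Z r x" "cdist x y \<le> s" "x \<in> carrier G" "y \<in> carrier G" "Z \<subseteq> carrier G"
  shows "near Z (r + s) y"
proof -
  obtain z where "z \<in> Z" "cdist x z \<le> r" using assms(1) by (auto simp: near_def)
  moreover have "cdist y z \<le> cdist y x + cdist x z"
    using assms \<open>z \<in> Z\<close> by (intro cdist_triangle) auto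
  ultimately show ?thesis using assms(2) by (auto simp: near_def cdist_sym intro!: bexI[of _ z])
qed

end

text \<open>Exponential growth of an intersection, seen from a suitable base point \<open>c\<close>, in a form with explicit
  constants that can be required of a whole family of pairs simultaneously.\<close>
definition exp_overlap :: "('g \<Rightarrow> 'g \<Rightarrow> real) \<Rightarrow> real \<Rightarrow> 'g set \<Rightarrow> 'g set \<Rightarrow> bool" where
  "exp_overlap d B Y Y' \<longleftrightarrow>
     (\<exists>c\<in>Y \<inter> Y'. \<forall>m::nat. 2 ^ m \<le> card {q \<in> Y \<inter> Y'. d c q \<le> B * real m})"

lemma exp_overlap_sym: "exp_overlap d B Y Y' = exp_overlap d B Y' Y"
  by (simp add: exp_overlap_def Int_commute)

text \<open>The two sources of uniformity are that all maps share the constants \<open>A\<close> and \<open>B\<close> and that all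
  preimages form one family: if this family fails to separate \<open>H\<close>, there is one distance beyond which
  the complement of a preimage has at most one component, for all maps and all members of \<open>\<Z>\<close> at once.\<close>
theorem coarse_separation_transfer:
  assumes G: "cayley_graph G S" and H: "cayley_graph H T"
    and sep: "coarsely_separated (carrier G) (cayley_dist G S) \<Z>"
    and sub: "subexponential_growth (carrier G) (cayley_dist G S) \<Z>"
    and A: "A > 0" and B: "B > 0"
    and maps: "\<And>f. f \<in> \<Phi> \<Longrightarrow> f \<in> carrier H \<rightarrow> carrier G"
    and inj: "\<And>f. f \<in> \<Phi> \<Longrightarrow> inj_on f (carrier H)"
    and lip: "\<And>f x y. f \<in> \<Phi> \<Longrightarrow> x \<in> carrier H \<Longrightarrow> y \<in> carrier H \<Longrightarrow>
      cayley_dist G S (f x) (f y) \<le> A * cayley_dist H T x y"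
    and cover: "\<And>g. g \<in> carrier G \<Longrightarrow> \<exists>f\<in>\<Phi>. g \<in> f ` carrier H"
    and linked: "\<And>f f'. f \<in> \<Phi> \<Longrightarrow> f' \<in> \<Phi> \<Longrightarrow>
      (f, f') \<in> {(f, f'). f \<in> \<Phi> \<and> f' \<in> \<Phi> \<and>
        exp_overlap (cayley_dist G S) B (f ` carrier H) (f' ` carrier H)}\<^sup>*"
  shows "subexp_coarsely_separable H"
proof -
  interpret G: cayley_graph G S by (rule G)
  interpret H: cayley_graph H T by (rule H)
  have Z_sub: "\<Union>\<Z> \<subseteq> carrier G"
    using sep by (auto simp: coarsely_separated_def)
  obtain k L where k: "k \<ge> 0" and L: "L \<ge> 0" and
    sep_D: "\<And>D. D \<ge> 0 \<Longrightarrow> \<exists>Z\<in>\<Z>. \<exists>C\<^sub>1 C\<^sub>2. C\<^sub>1 \<noteq> C\<^sub>2 \<and>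
          k_component G.cdist k (carrier G - thickening (carrier G) G.cdist Z L) C\<^sub>1 \<and>
          k_component G.cdist k (carrier G - thickening (carrier G) G.cdist Z L) C\<^sub>2 \<and>
          (\<exists>x\<in>C\<^sub>1. ereal D \<le> point_dist G.cdist x Z) \<and>
          (\<exists>x\<in>C\<^sub>2. ereal D \<le> point_dist G.cdist x Z)"
    and conn: "k_connected G.cdist k (carrier G)"
    using sep unfolding coarsely_separated_def by blast
  \<comment> \<open>Chosen so that a path of length at most \<open>A\<close> from a point that is not within \<open>M\<close> of \<open>Z\<close> avoids the
    \<open>L\<close>-thickening of \<open>Z\<close>.\<close>
  define M where "M = A + L + 1"
  define pre where "pre f Z = {x \<in> carrier H. G.near Z M (f x)}" for f Z
  define \<Z>' where "\<Z>' = {pre f Z | f Z. f \<in> \<Phi> \<and> Z \<in> \<Z>}"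

  have growth: "subexponential_growth (carrier H) H.cdist \<Z>'"
  proof (rule H.subexponential_growthI)
    fix \<epsilon> :: real assume "\<epsilon> > 0"
    from G.subexponential_growth_near[OF sub Z_sub A this, of M]
    show "\<forall>\<^sub>F R in at_top. \<forall>Z\<in>\<Z>'. \<forall>z\<in>Z. real (card ({x \<in> carrier H. H.cdist z x \<le> R} \<inter> Z)) \<le> exp (\<epsilon> * R)"
    proof eventually_elim
      case (elim R)
      show ?case
      proof (intro ballI)
        fix Y x assume Y: "Y \<in> \<Z>'" and x: "x \<in> Y"
        obtain f Z where fZ: "f \<in> \<Phi>" "Z \<in> \<Z>" "Y = pre f Z" using Y by (auto simp: \<Z>'_def)
        have x': "x \<in> carrier H" "G.near Z M (f x)" "f x \<in> carrier G"
          using x fZ maps by (auto simp: pre_def)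
        let ?N = "{q \<in> carrier G. G.cdist (f x) q \<le> A * R \<and> G.near Z M q}"
        have "f ` ({y \<in> carrier H. H.cdist x y \<le> R} \<inter> Y) \<subseteq> ?N"
        proof (intro subsetI, elim imageE)
          fix q y assume q: "q = f y" and y: "y \<in> {y \<in> carrier H. H.cdist x y \<le> R} \<inter> Y"
          have "G.cdist (f x) (f y) \<le> A * H.cdist x y" using lip fZ x' y by auto
          also have "\<dots> \<le> A * R" using y A by auto
          finally show "q \<in> ?N" using q y fZ maps by (auto simp: pre_def)
        qed
        then have "card ({y \<in> carrier H. H.cdist x y \<le> R} \<inter> Y) \<le> card ?N"
        proof (rule card_inj_on_le[rotated])
          show "finite ?N" by (rule rev_finite_subset[OF G.finite_cball[OF x'(3), of "A * R"]]) auto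
          show "inj_on f ({y \<in> carrier H. H.cdist x y \<le> R} \<inter> Y)"
            by (rule inj_on_subset[OF inj[OF fZ(1)]]) auto
        qed
        moreover have "real (card ?N) \<le> exp (\<epsilon> * R)" using elim fZ x' by blast
        ultimately show "real (card ({y \<in> carrier H. H.cdist x y \<le> R} \<inter> Y)) \<le> exp (\<epsilon> * R)"
          by linarith
      qed
    qed
  qed

  have "coarsely_separated (carrier H) H.cdist \<Z>'"
  proof (rule ccontr)
    assume not_sep: "\<not> coarsely_separated (carrier H) H.cdist \<Z>'"
    have "\<forall>Y\<in>\<Z>'. Y \<subseteq> carrier H" by (auto simp: \<Z>'_def pre_def)
    then obtain D0 where "D0 \<ge> 0" and D0: "\<And>Z C\<^sub>1 C\<^sub>2. Z \<in> \<Z>' \<Longrightarrow>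
          k_component H.cdist 1 (carrier H - thickening (carrier H) H.cdist Z 0) C\<^sub>1 \<Longrightarrow>
          k_component H.cdist 1 (carrier H - thickening (carrier H) H.cdist Z 0) C\<^sub>2 \<Longrightarrow>
          (\<exists>x\<in>C\<^sub>1. ereal D0 \<le> point_dist H.cdist x Z) \<Longrightarrow>
          (\<exists>x\<in>C\<^sub>2. ereal D0 \<le> point_dist H.cdist x Z) \<Longrightarrow> C\<^sub>1 = C\<^sub>2"
      using not_sep H.k_connected_carrier unfolding coarsely_separated_def
      by (metis (no_types, lifting) order_refl zero_le_one)
    \<comment> \<open>A point of a copy at distance more than \<open>D\<close> from \<open>Z\<close> comes from a point at distance more than \<open>D0\<close>
      from the preimage of the \<open>M\<close>-thickening of \<open>Z\<close>; the summand \<open>1\<close> makes this distance positive.\<close>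
    define D where "D = A * (D0 + 1) + M"
    have "0 \<le> A * (D0 + 1)" using A \<open>D0 \<ge> 0\<close> by simp
    then have "D + 1 \<ge> 0" using A L by (simp add: D_def M_def)
    from sep_D[OF this] obtain Z C\<^sub>1 C\<^sub>2 x\<^sub>1 x\<^sub>2 where Z: "Z \<in> \<Z>" and "C\<^sub>1 \<noteq> C\<^sub>2" and
      C: "k_component G.cdist k (carrier G - thickening (carrier G) G.cdist Z L) C\<^sub>1"
         "k_component G.cdist k (carrier G - thickening (carrier G) G.cdist Z L) C\<^sub>2"
      and x: "x\<^sub>1 \<in> C\<^sub>1" "x\<^sub>2 \<in> C\<^sub>2"
      and far: "ereal (D + 1) \<le> point_dist G.cdist x\<^sub>1 Z" "ereal (D + 1) \<le> point_dist G.cdist x\<^sub>2 Z"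
      by blast
    have Zc: "Z \<subseteq> carrier G" using Z Z_sub by blast
    let ?X = "carrier G - thickening (carrier G) G.cdist Z L"
    let ?R = "chain_rel G.cdist k ?X"
    have xX: "x\<^sub>1 \<in> ?X" "x\<^sub>2 \<in> ?X" using C x unfolding k_component_def by auto
    have x_far: "\<not> G.near Z D x\<^sub>1" "\<not> G.near Z D x\<^sub>2"
      using far by (auto dest: G.not_near_of_far[where r = D])
    have C_eq: "C\<^sub>1 = {y. (x\<^sub>1, y) \<in> ?R\<^sup>*}" "C\<^sub>2 = {y. (x\<^sub>2, y) \<in> ?R\<^sup>*}"
      by (rule G.component_eq_chain_class[OF C(1) x(1)], rule G.component_eq_chain_class[OF C(2) x(2)])
    have not_chain: "(x\<^sub>1, x\<^sub>2) \<notin> ?R\<^sup>*"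
    proof
      assume "(x\<^sub>1, x\<^sub>2) \<in> ?R\<^sup>*"
      then have "x\<^sub>2 \<in> C\<^sub>1" by (simp add: C_eq(1))
      with C(1) have "C\<^sub>1 = {y. (x\<^sub>2, y) \<in> ?R\<^sup>*}" by (rule G.component_eq_chain_class)
      with C_eq(2) \<open>C\<^sub>1 \<noteq> C\<^sub>2\<close> show False by simp
    qed
    \<comment> \<open>Distances are integers, so a space with two points is not \<open>k\<close>-connected for \<open>k < 1\<close>.\<close>
    have k1: "k \<ge> 1"
    proof (rule ccontr)
      assume "\<not> k \<ge> 1"
      then have sub_Id: "chain_rel G.cdist k (carrier G) \<subseteq> Id"
        by (auto intro!: G.cdist_less_one)
      have id: "x = y" if "(x, y) \<in> (chain_rel G.cdist k (carrier G))\<^sup>*" for x y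
        using that by (induction rule: rtrancl_induct) (use sub_Id in blast)+
      have "x\<^sub>1 = x\<^sub>2" by (rule id) (use conn xX in \<open>simp add: k_connected_def\<close>)
      with not_chain show False by blast
    qed

    have near_path: "(a, b) \<in> ?R\<^sup>*"
      if ab: "a \<in> carrier G" "b \<in> carrier G" "G.cdist a b \<le> A" "\<not> G.near Z M a" for a b
    proof -
      have "(a, b) \<in> (chain_rel G.cdist 1 ?X)\<^sup>*"
      proof (rule G.chain_near[OF ab(1,2)])
        fix q assume q: "q \<in> carrier G" "G.cdist a q \<le> G.cdist a b"
        have "\<not> G.near Z (L + 1) q"
        proof
          assume "G.near Z (L + 1) q"
          then have "G.near Z (L + 1 + A) a"
            by (rule G.near_translate) (use q ab Zc in \<open>auto simp: G.cdist_sym\<close>)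
          with ab(4) show False by (simp add: M_def add_ac)
        qed
        then show "q \<in> ?X" using q(1) G.not_in_thickening by blast
      qed
      moreover have "(chain_rel G.cdist 1 ?X)\<^sup>* \<subseteq> ?R\<^sup>*"
        by (rule rtrancl_mono) (use k1 in auto)
      ultimately show ?thesis by blast
    qed

    \<comment> \<open>Inside one copy, all points far from \<open>Z\<close> lie in the same component.\<close>
    have piece: "(f x, f y) \<in> ?R\<^sup>*"
      if f: "f \<in> \<Phi>" and xy: "x \<in> carrier H" "y \<in> carrier H"
        and nn: "\<not> G.near Z D (f x)" "\<not> G.near Z D (f y)" for f x y
    proof -
      let ?Y = "carrier H - thickening (carrier H) H.cdist (pre f Z) 0"
      have Y: "pre f Z \<in> \<Z>'" using f Z by (auto simp: \<Z>'_def)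
      have far': "ereal (D0 + 1) \<le> point_dist H.cdist w (pre f Z)"
        if w: "w \<in> carrier H" "\<not> G.near Z D (f w)" for w
        unfolding point_dist_def
      proof (rule INF_greatest)
        fix z assume z: "z \<in> pre f Z"
        then have zc: "z \<in> carrier H" "G.near Z M (f z)" by (auto simp: pre_def)
        have "\<not> H.cdist w z < D0 + 1"
        proof
          assume less: "H.cdist w z < D0 + 1"
          have "G.cdist (f z) (f w) \<le> A * H.cdist w z"
            using lip[OF f w(1) zc(1)] by (simp add: G.cdist_sym)
          also have "\<dots> \<le> A * (D0 + 1)" using less A by simp
          finally have "G.near Z (M + A * (D0 + 1)) (f w)"
            using maps[OF f] w zc Zc by (intro G.near_translate[OF zc(2)]) auto
          with w show False by (simp add: D_def add.commute)
        qed
        then show "ereal (D0 + 1) \<le> ereal (H.cdist w z)" by simp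
      qed
      have far0: "ereal D0 \<le> point_dist H.cdist w (pre f Z)"
        if w: "w \<in> carrier H" "\<not> G.near Z D (f w)" for w
        using far'[OF w] by (rule order_trans[rotated]) simp
      have in_Y: "w \<in> ?Y" if w: "w \<in> carrier H" "\<not> G.near Z D (f w)" for w
      proof -
        have "ereal 0 < ereal (D0 + 1)" using \<open>D0 \<ge> 0\<close> by simp
        with far'[OF w] have "\<not> point_dist H.cdist w (pre f Z) \<le> ereal 0"
          by (metis not_le order_less_le_trans)
        then show ?thesis using w(1) by (simp add: thickening_def)
      qed
      let ?Q = "chain_rel H.cdist 1 ?Y"
      have "{z. (x, z) \<in> ?Q\<^sup>*} = {z. (y, z) \<in> ?Q\<^sup>*}"
      proof (rule D0[OF Y])
        show "k_component H.cdist 1 ?Y {z. (x, z) \<in> ?Q\<^sup>*}" "k_component H.cdist 1 ?Y {z. (y, z) \<in> ?Q\<^sup>*}"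
          by (rule H.component_chain_class[OF in_Y[OF xy(1) nn(1)]],
              rule H.component_chain_class[OF in_Y[OF xy(2) nn(2)]])
        show "\<exists>w\<in>{z. (x, z) \<in> ?Q\<^sup>*}. ereal D0 \<le> point_dist H.cdist w (pre f Z)"
          using far0[OF xy(1) nn(1)] by blast
        show "\<exists>w\<in>{z. (y, z) \<in> ?Q\<^sup>*}. ereal D0 \<le> point_dist H.cdist w (pre f Z)"
          using far0[OF xy(2) nn(2)] by blast
      qed
      then have "(x, y) \<in> ?Q\<^sup>*" by blast
      then show ?thesis
      proof (induction rule: rtrancl_induct)
        case (step a b)
        then have ab: "a \<in> ?Y" "b \<in> ?Y" "H.cdist a b \<le> 1" by auto
        have "G.cdist (f a) (f b) \<le> A * H.cdist a b" using lip[OF f] ab by blast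
        also have "\<dots> \<le> A" using ab A by (simp add: mult_left_le)
        finally have "G.cdist (f a) (f b) \<le> A" .
        moreover have "\<not> G.near Z M (f a)"
        proof
          assume "G.near Z M (f a)"
          then have "a \<in> pre f Z" using ab by (auto simp: pre_def)
          then have "point_dist H.cdist a (pre f Z) \<le> ereal (H.cdist a a)"
            unfolding point_dist_def by (rule INF_lower)
          then show False using ab by (simp add: thickening_def zero_ereal_def)
        qed
        ultimately have "(f a, f b) \<in> ?R\<^sup>*"
          using maps[OF f] ab by (intro near_path) auto
        with step.IH show ?case by (rule rtrancl_trans)
      qed simp
    qed

    \<comment> \<open>An overlap contained in a thickening of \<open>Z\<close> would have too many points.\<close>
    have far_overlap: "\<exists>q\<in>Y \<inter> Y'. \<not> G.near Z D q"
      if o: "exp_overlap G.cdist B Y Y'" and Y: "Y \<subseteq> carrier G" for Y Y'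
    proof (rule ccontr)
      assume all_near: "\<not> (\<exists>q\<in>Y \<inter> Y'. \<not> G.near Z D q)"
      obtain c where c: "c \<in> Y \<inter> Y'" "\<And>m::nat. 2 ^ m \<le> card {q \<in> Y \<inter> Y'. G.cdist c q \<le> B * real m}"
        using o by (auto simp: exp_overlap_def)
      have cc: "c \<in> carrier G" using c Y by auto
      have ln2: "0 < ln 2 / (2::real)" by simp
      have "\<forall>\<^sub>F R in at_top. real (card {x \<in> carrier G. G.cdist c x \<le> B * R \<and> G.near Z D x}) \<le> exp (ln 2 / 2 * R)"
        using G.subexponential_growth_near[OF sub Z_sub B ln2, of D]
      proof eventually_elim
        case (elim R)
        then show ?case using Z cc c(1) all_near by blast
      qed
      then have "\<forall>\<^sub>F n in sequentially. real (card {x \<in> carrier G. G.cdist c x \<le> B * real n \<and> G.near Z D x}) \<le> exp (ln 2 / 2 * real n)"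
        by (rule eventually_compose_filterlim[OF _ filterlim_real_sequentially])
      then obtain n0 where n0: "\<And>n. n \<ge> n0 \<Longrightarrow> real (card {x \<in> carrier G. G.cdist c x \<le> B * real n \<and> G.near Z D x}) \<le> exp (ln 2 / 2 * real n)"
        by (auto simp: eventually_sequentially)
      \<comment> \<open>A positive radius, so that the two exponential bounds below differ strictly.\<close>
      define n where "n = Suc n0"
      have "{q \<in> Y \<inter> Y'. G.cdist c q \<le> B * real n} \<subseteq> {x \<in> carrier G. G.cdist c x \<le> B * real n \<and> G.near Z D x}"
        using all_near Y by auto
      then have "card {q \<in> Y \<inter> Y'. G.cdist c q \<le> B * real n} \<le> card {x \<in> carrier G. G.cdist c x \<le> B * real n \<and> G.near Z D x}"
        by (intro card_mono rev_finite_subset[OF G.finite_cball[OF cc, of "B * real n"]]) auto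
      with c(2)[of n] have "2 ^ n \<le> card {x \<in> carrier G. G.cdist c x \<le> B * real n \<and> G.near Z D x}"
        by (rule order_trans)
      then have "(2::real) ^ n \<le> real (card {x \<in> carrier G. G.cdist c x \<le> B * real n \<and> G.near Z D x})"
        by (metis of_nat_le_iff of_nat_numeral of_nat_power)
      also have "\<dots> \<le> exp (ln 2 / 2 * real n)" by (rule n0) (simp add: n_def)
      also have "\<dots> < exp (ln 2 * real n)" by (simp add: n_def)
      also have "\<dots> = 2 ^ n" by (simp add: exp_of_nat_mult mult.commute)
      finally show False by simp
    qed

    obtain f\<^sub>1 f\<^sub>2 where f: "f\<^sub>1 \<in> \<Phi>" "x\<^sub>1 \<in> f\<^sub>1 ` carrier H" "f\<^sub>2 \<in> \<Phi>" "x\<^sub>2 \<in> f\<^sub>2 ` carrier H"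
      using cover xX by (metis DiffD1)
    have "\<forall>q\<in>f ` carrier H. \<not> G.near Z D q \<longrightarrow> (x\<^sub>1, q) \<in> ?R\<^sup>*"
      if "(f\<^sub>1, f) \<in> {(f, f'). f \<in> \<Phi> \<and> f' \<in> \<Phi> \<and>
        exp_overlap G.cdist B (f ` carrier H) (f' ` carrier H)}\<^sup>*" for f
      using that
    proof (induction rule: rtrancl_induct)
      case base
      show ?case
      proof (intro ballI impI)
        fix q assume "q \<in> f\<^sub>1 ` carrier H" "\<not> G.near Z D q"
        then obtain a b where "a \<in> carrier H" "x\<^sub>1 = f\<^sub>1 a" "b \<in> carrier H" "q = f\<^sub>1 b"
            "\<not> G.near Z D (f\<^sub>1 b)"
          using f(2) by auto
        then show "(x\<^sub>1, q) \<in> ?R\<^sup>*" using piece[OF f(1), of a b] x_far(1) by simp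
      qed
    next
      case (step g h)
      then have gh: "g \<in> \<Phi>" "h \<in> \<Phi>" "exp_overlap G.cdist B (g ` carrier H) (h ` carrier H)" by auto
      obtain q where q: "q \<in> g ` carrier H \<inter> h ` carrier H" "\<not> G.near Z D q"
        using far_overlap[OF gh(3)] maps[OF gh(1)] by blast
      have q1: "(x\<^sub>1, q) \<in> ?R\<^sup>*" using step.IH q by blast
      show ?case
      proof (intro ballI impI)
        fix r assume "r \<in> h ` carrier H" "\<not> G.near Z D r"
        then obtain a b where "a \<in> carrier H" "q = h a" "b \<in> carrier H" "r = h b"
          using q by auto
        then have "(q, r) \<in> ?R\<^sup>*"
          using piece[OF gh(2), of a b] q(2) \<open>\<not> G.near Z D r\<close> by simp
        with q1 show "(x\<^sub>1, r) \<in> ?R\<^sup>*" by (rule rtrancl_trans)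
      qed
    qed
    from this[OF linked[OF f(1,3)], rule_format, OF f(4) x_far(2)]
    have "(x\<^sub>1, x\<^sub>2) \<in> ?R\<^sup>*" .
    with not_chain show False by simp
  qed
  with growth H.gen show ?thesis unfolding subexp_coarsely_separable_def by blast
qed

section \<open>Maps of graph products induced by maps of the factors\<close>

lemma (in group) commute_inv_left:
  assumes "x \<in> carrier G" "y \<in> carrier G" "x \<otimes> y = y \<otimes> x"
  shows "inv x \<otimes> y = y \<otimes> inv x"
proof -
  have "inv x \<otimes> y = inv x \<otimes> (y \<otimes> x) \<otimes> inv x" using assms by (simp add: m_assoc)
  also have "\<dots> = y \<otimes> inv x" using assms(1,2) by (simp add: assms(3)[symmetric] m_assoc[symmetric])
  finally show ?thesis .
qed

lemma (in group) commute_mult_left: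
  assumes "x \<in> carrier G" "y \<in> carrier G" "z \<in> carrier G" "x \<otimes> z = z \<otimes> x" "y \<otimes> z = z \<otimes> y"
  shows "(x \<otimes> y) \<otimes> z = z \<otimes> (x \<otimes> y)"
  using assms by (metis m_assoc)

text \<open>Used for \<open>f(r)\<^sup>-\<^sup>1 f(r g)\<close> with \<open>f\<close> defined on one factor, and the same expression for an adjacent
  factor.\<close>
lemma (in group) commute_quotients:
  assumes c: "a \<in> carrier G" "a' \<in> carrier G" "b \<in> carrier G" "b' \<in> carrier G"
    and "a \<otimes> b = b \<otimes> a" "a \<otimes> b' = b' \<otimes> a" "a' \<otimes> b = b \<otimes> a'" "a' \<otimes> b' = b' \<otimes> a'"
  shows "(inv a \<otimes> a') \<otimes> (inv b \<otimes> b') = (inv b \<otimes> b') \<otimes> (inv a \<otimes> a')"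
proof (rule commute_mult_left)
  have 1: "x \<otimes> (inv b \<otimes> b') = (inv b \<otimes> b') \<otimes> x"
    if "x \<in> carrier G" "x \<otimes> b = b \<otimes> x" "x \<otimes> b' = b' \<otimes> x" for x
    using commute_mult_left[of "inv b" b' x] commute_inv_left[of b x] that c by simp
  show "inv a \<otimes> (inv b \<otimes> b') = (inv b \<otimes> b') \<otimes> inv a"
    using commute_inv_left[of a "inv b \<otimes> b'"] 1[of a] assms by simp
  show "a' \<otimes> (inv b \<otimes> b') = (inv b \<otimes> b') \<otimes> a'" using 1[of a'] assms by simp
qed (use c in auto)

text \<open>The retraction of the graph product to the factor at \<open>u\<close> that kills all other factors. It exists by
  the universal property.\<close>
definition gp_retract ::
  "'v set \<Rightarrow> 'v set set \<Rightarrow> ('v \<Rightarrow> ('a, 'b) monoid_scheme) \<Rightarrow> 'v \<Rightarrow> ('v \<times> 'a) list set \<Rightarrow> 'a" where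
  "gp_retract V E G u = (SOME r. r \<in> hom (graph_product V E G) (G u) \<and>
     (\<forall>v\<in>V. \<forall>g\<in>carrier (G v). r (gp_incl V E G v g) = (if v = u then g else \<one>\<^bsub>G u\<^esub>)))"

locale group_graph =
  fixes V :: "'v set" and E :: "'v set set" and G :: "'v \<Rightarrow> ('a, 'b) monoid_scheme"
  assumes simple: "simple_graph V E" and factors: "\<And>v. v \<in> V \<Longrightarrow> group (G v)"
begin

abbreviation GP :: "('v \<times> 'a) list set monoid" where "GP \<equiv> graph_product V E G"
abbreviation incl :: "'v \<Rightarrow> 'a \<Rightarrow> ('v \<times> 'a) list set" where "incl \<equiv> gp_incl V E G"
abbreviation retract :: "'v \<Rightarrow> ('v \<times> 'a) list set \<Rightarrow> 'a" where "retract \<equiv> gp_retract V E G"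
abbreviation cls :: "('v \<times> 'a) list \<Rightarrow> ('v \<times> 'a) list set" where "cls xs \<equiv> gp_rel V E G `` {xs}"

sublocale P: group "graph_product V E G"
  by (rule group_graph_product[OF factors])

lemma edge_neq: "{u, v} \<in> E \<Longrightarrow> u \<noteq> v"
  using simple by (auto simp: simple_graph_def)

lemma incl_closed: "v \<in> V \<Longrightarrow> g \<in> carrier (G v) \<Longrightarrow> incl v g \<in> carrier GP"
  using gp_incl_hom[where V=V and E=E and G=G, OF factors] by (auto simp: hom_def)

lemma incl_mult:
  "v \<in> V \<Longrightarrow> g \<in> carrier (G v) \<Longrightarrow> h \<in> carrier (G v) \<Longrightarrow>
    incl v (g \<otimes>\<^bsub>G v\<^esub> h) = incl v g \<otimes>\<^bsub>GP\<^esub> incl v h"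
  using gp_incl_hom[where V=V and E=E and G=G, OF factors] by (auto simp: hom_def)

lemma incl_one: "v \<in> V \<Longrightarrow> incl v \<one>\<^bsub>G v\<^esub> = \<one>\<^bsub>GP\<^esub>"
  by (rule hom_one[OF gp_incl_hom[where V=V and E=E and G=G, OF factors] factors P.is_group])

lemma incl_inv:
  assumes "v \<in> V" "g \<in> carrier (G v)"
  shows "incl v (inv\<^bsub>G v\<^esub> g) = inv\<^bsub>GP\<^esub> (incl v g)"
proof -
  interpret group_hom "G v" GP "incl v"
    using assms(1) factors gp_incl_hom[where V=V and E=E and G=G, OF factors assms(1)] P.is_group
    by (simp add: group_hom_def group_hom_axioms_def)
  show ?thesis by (rule hom_inv[OF assms(2)])
qed

lemma incl_conv_cls: "incl v g = cls [(v, g)]"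
  by (simp add: gp_incl_def)

lemma cls_nil: "cls [] = \<one>\<^bsub>GP\<^esub>"
  by (simp add: graph_product_def)

lemma snoc_words:
  "xs @ [(v, g)] \<in> gp_words V G \<longleftrightarrow> xs \<in> gp_words V G \<and> v \<in> V \<and> g \<in> carrier (G v)"
  by (auto simp: gp_words_def)

lemma cls_closed: "xs \<in> gp_words V G \<Longrightarrow> cls xs \<in> carrier GP"
  by (simp add: graph_product_def quotientI)

lemma cls_snoc:
  assumes "xs \<in> gp_words V G" "v \<in> V" "g \<in> carrier (G v)"
  shows "cls (xs @ [(v, g)]) = cls xs \<otimes>\<^bsub>GP\<^esub> incl v g"
proof -
  have "[(v, g)] \<in> gp_words V G" using assms by (auto simp: gp_words_def)
  from gp_class_mult[where V=V and E=E and G=G, OF factors assms(1) this] show ?thesis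
    by (simp add: incl_conv_cls)
qed

lemma carrier_cls: "x \<in> carrier GP \<Longrightarrow> \<exists>xs\<in>gp_words V G. x = cls xs"
  by (auto simp: graph_product_def elim: quotientE)

lemma gp_induct [consumes 1, case_names one step]:
  assumes "x \<in> carrier GP"
    and one: "Q \<one>\<^bsub>GP\<^esub>"
    and step: "\<And>x v g. x \<in> carrier GP \<Longrightarrow> Q x \<Longrightarrow> v \<in> V \<Longrightarrow> g \<in> carrier (G v) \<Longrightarrow>
      Q (x \<otimes>\<^bsub>GP\<^esub> incl v g)"
  shows "Q x"
proof -
  have "Q (cls xs)" if "xs \<in> gp_words V G" for xs
    using that
  proof (induction xs rule: rev_induct)
    case Nil
    then show ?case using one by (simp add: cls_nil)
  next
    case (snoc a xs)
    obtain v g where a: "a = (v, g)" by (cases a)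
    have "xs \<in> gp_words V G" "v \<in> V" "g \<in> carrier (G v)"
      using snoc.prems unfolding a snoc_words by auto
    with snoc.IH step[OF cls_closed] show ?case by (simp add: a cls_snoc)
  qed
  with carrier_cls[OF assms(1)] show ?thesis by auto
qed

lemma retract_props:
  assumes u: "u \<in> V"
  shows "retract u \<in> hom GP (G u)"
    and "v \<in> V \<Longrightarrow> g \<in> carrier (G v) \<Longrightarrow> retract u (incl v g) = (if v = u then g else \<one>\<^bsub>G u\<^esub>)"
proof -
  interpret Gu: group "G u" by (rule factors[OF u])
  have f: "(\<lambda>g. if v = u then g else \<one>\<^bsub>G u\<^esub>) \<in> hom (G v) (G u)" for v
    by (auto simp: hom_def)
  have comm: "(if a = u then g else \<one>\<^bsub>G u\<^esub>) \<otimes>\<^bsub>G u\<^esub> (if b = u then h else \<one>\<^bsub>G u\<^esub>) =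
      (if b = u then h else \<one>\<^bsub>G u\<^esub>) \<otimes>\<^bsub>G u\<^esub> (if a = u then g else \<one>\<^bsub>G u\<^esub>)"
    if "{a, b} \<in> E" "g \<in> carrier (G a)" "h \<in> carrier (G b)" for a b g h
    using edge_neq[OF that(1)] that(2,3) by auto
  have "\<exists>r\<in>hom GP (G u). \<forall>v\<in>V. \<forall>g\<in>carrier (G v). r (incl v g) = (if v = u then g else \<one>\<^bsub>G u\<^esub>)"
    by (rule gp_hom_exists[where V=V and E=E and G=G and f = "\<lambda>v g. if v = u then g else \<one>\<^bsub>G u\<^esub>",
          OF factors Gu.is_group f comm])
  then have "\<exists>r. r \<in> hom GP (G u) \<and> (\<forall>v\<in>V. \<forall>g\<in>carrier (G v). r (incl v g) = (if v = u then g else \<one>\<^bsub>G u\<^esub>))"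
    by blast
  from someI_ex[OF this, folded gp_retract_def]
  show "retract u \<in> hom GP (G u)"
    and "v \<in> V \<Longrightarrow> g \<in> carrier (G v) \<Longrightarrow> retract u (incl v g) = (if v = u then g else \<one>\<^bsub>G u\<^esub>)"
    by blast+
qed

lemma retract_closed: "u \<in> V \<Longrightarrow> x \<in> carrier GP \<Longrightarrow> retract u x \<in> carrier (G u)"
  using retract_props(1) by (auto simp: hom_def)

lemma retract_mult: "u \<in> V \<Longrightarrow> x \<in> carrier GP \<Longrightarrow> y \<in> carrier GP \<Longrightarrow>
    retract u (x \<otimes>\<^bsub>GP\<^esub> y) = retract u x \<otimes>\<^bsub>G u\<^esub> retract u y"
  using retract_props(1) by (auto simp: hom_def)

lemma retract_one: "u \<in> V \<Longrightarrow> retract u \<one>\<^bsub>GP\<^esub> = \<one>\<^bsub>G u\<^esub>"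
  by (rule hom_one[OF retract_props(1) P.is_group factors])

lemma retract_step:
  assumes "u \<in> V" "x \<in> carrier GP" "v \<in> V" "g \<in> carrier (G v)"
  shows "retract u (x \<otimes>\<^bsub>GP\<^esub> incl v g) = (if v = u then retract u x \<otimes>\<^bsub>G u\<^esub> g else retract u x)"
proof -
  interpret Gu: group "G u" by (rule factors[OF assms(1)])
  show ?thesis
    using assms retract_closed[OF assms(1,2)]
    by (simp add: retract_mult incl_closed retract_props(2))
qed

text \<open>Words act on pairs of an element of \<open>M\<close> and a tuple of states, one in each factor; a letter \<open>g\<close> at \<open>v\<close>
  changes the state \<open>a\<close> at \<open>v\<close> to \<open>a g\<close> and multiplies the element of \<open>M\<close> by \<open>f(a)\<^sup>-\<^sup>1 f(a g)\<close>. The product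
  over consecutive letters of one factor telescopes, which gives the relations inside the factors, and
  letters of adjacent factors change different states by commuting elements. So congruent words act in
  the same way. The states reached from the identity are the values of the retractions.\<close>
theorem gp_cocycle_exists:
  assumes M: "group M"
    and f: "\<And>v. v \<in> V \<Longrightarrow> f v \<in> carrier (G v) \<rightarrow> carrier M"
    and comm: "\<And>u v g h. u \<in> V \<Longrightarrow> v \<in> V \<Longrightarrow> {u, v} \<in> E \<Longrightarrow> g \<in> carrier (G u) \<Longrightarrow>
      h \<in> carrier (G v) \<Longrightarrow> f u g \<otimes>\<^bsub>M\<^esub> f v h = f v h \<otimes>\<^bsub>M\<^esub> f u g"
  shows "\<exists>\<Phi>\<in>carrier GP \<rightarrow> carrier M. \<Phi> \<one>\<^bsub>GP\<^esub> = \<one>\<^bsub>M\<^esub> \<and>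
    (\<forall>x\<in>carrier GP. \<forall>v\<in>V. \<forall>g\<in>carrier (G v). \<Phi> (x \<otimes>\<^bsub>GP\<^esub> incl v g) =
       \<Phi> x \<otimes>\<^bsub>M\<^esub> (inv\<^bsub>M\<^esub> (f v (retract v x)) \<otimes>\<^bsub>M\<^esub> f v (retract v x \<otimes>\<^bsub>G v\<^esub> g)))"
proof -
  interpret M: group M by (rule M)
  define \<delta> where "\<delta> v a g = inv\<^bsub>M\<^esub> (f v a) \<otimes>\<^bsub>M\<^esub> f v (a \<otimes>\<^bsub>G v\<^esub> g)" for v a g
  define step where "step = (\<lambda>(m, s) (v, g). (m \<otimes>\<^bsub>M\<^esub> \<delta> v (s v) g, s(v := s v \<otimes>\<^bsub>G v\<^esub> g)))"
  define valid where "valid st \<longleftrightarrow> fst st \<in> carrier M \<and> (\<forall>v\<in>V. snd st v \<in> carrier (G v))"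
    for st :: "'c \<times> ('v \<Rightarrow> 'a)"
  have step: "step (m, s) (v, g) = (m \<otimes>\<^bsub>M\<^esub> \<delta> v (s v) g, s(v := s v \<otimes>\<^bsub>G v\<^esub> g))" for m s v g
    by (simp add: step_def)
  have mc: "a \<otimes>\<^bsub>G v\<^esub> g \<in> carrier (G v)" if "v \<in> V" "a \<in> carrier (G v)" "g \<in> carrier (G v)" for v a g
    using factors[OF that(1)] that by (simp add: group.is_monoid monoid.m_closed)
  have fc: "f v a \<in> carrier M" if "v \<in> V" "a \<in> carrier (G v)" for v a
    using f[OF that(1)] that by auto
  have \<delta>c: "\<delta> v a g \<in> carrier M" if "v \<in> V" "a \<in> carrier (G v)" "g \<in> carrier (G v)" for v a g
    using that by (simp add: \<delta>_def fc mc)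
  have valid_step: "valid (step st (v, g))" if "valid st" "v \<in> V" "g \<in> carrier (G v)" for st v g
    using that by (cases st) (simp add: valid_def step \<delta>c mc)
  have valid_run: "valid (foldl step st xs)" if "valid st" "xs \<in> gp_words V G" for st xs
    using that
  proof (induction xs rule: rev_induct)
    case (snoc a xs)
    obtain v g where a: "a = (v, g)" by (cases a)
    from snoc show ?case unfolding a snoc_words by (simp add: valid_step)
  qed simp
  have run_cong: "foldl step st xs = foldl step st ys" if "gp_cong V E G xs ys" "valid st" for xs ys st
    using that
  proof (induction arbitrary: st)
    case (append xs xs' ys ys')
    have "valid (foldl step st xs)"
      using gp_cong_words[OF append.hyps(1)] factors append.prems by (blast intro: valid_run)
    then show ?case using append.IH(1)[OF append.prems] append.IH(2) by simp
  next
    case (one v)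
    interpret Gv: group "G v" by (rule factors[OF one(1)])
    obtain m s where st: "st = (m, s)" by (cases st)
    then have "m \<in> carrier M" "s v \<in> carrier (G v)" using one by (auto simp: valid_def)
    then show ?case using one by (simp add: st step \<delta>_def fc)
  next
    case (mult v g h)
    interpret Gv: group "G v" by (rule factors[OF mult(1)])
    obtain m s where st: "st = (m, s)" by (cases st)
    then have c: "m \<in> carrier M" "s v \<in> carrier (G v)" using mult by (auto simp: valid_def)
    have "\<delta> v (s v) g \<otimes>\<^bsub>M\<^esub> \<delta> v (s v \<otimes>\<^bsub>G v\<^esub> g) h = \<delta> v (s v) (g \<otimes>\<^bsub>G v\<^esub> h)"
    proof -
      have "inv\<^bsub>M\<^esub> p \<otimes>\<^bsub>M\<^esub> q \<otimes>\<^bsub>M\<^esub> (inv\<^bsub>M\<^esub> q \<otimes>\<^bsub>M\<^esub> r) = inv\<^bsub>M\<^esub> p \<otimes>\<^bsub>M\<^esub> r"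
        if "p \<in> carrier M" "q \<in> carrier M" "r \<in> carrier M" for p q r
        using that by (metis M.inv_closed M.inv_solve_left M.m_assoc M.m_closed)
      from this[of "f v (s v)" "f v (s v \<otimes>\<^bsub>G v\<^esub> g)" "f v (s v \<otimes>\<^bsub>G v\<^esub> g \<otimes>\<^bsub>G v\<^esub> h)"]
      show ?thesis using mult c by (simp add: \<delta>_def fc Gv.m_assoc)
    qed
    then show ?case using mult c by (simp add: st step M.m_assoc \<delta>c Gv.m_assoc)
  next
    case (commute u v g h)
    obtain m s where st: "st = (m, s)" by (cases st)
    then have c: "m \<in> carrier M" "s u \<in> carrier (G u)" "s v \<in> carrier (G v)"
      using commute by (auto simp: valid_def)
    have "\<delta> u (s u) g \<otimes>\<^bsub>M\<^esub> \<delta> v (s v) h = \<delta> v (s v) h \<otimes>\<^bsub>M\<^esub> \<delta> u (s u) g"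
      unfolding \<delta>_def
      by (rule M.commute_quotients) (use commute c in \<open>auto intro!: comm fc mc\<close>)
    then show ?case using commute c edge_neq[of u v]
      by (simp add: st step M.m_assoc \<delta>c fun_upd_twist)
  qed auto
  define st0 where "st0 = (\<one>\<^bsub>M\<^esub>, \<lambda>v. \<one>\<^bsub>G v\<^esub>)"
  have st0: "valid st0"
    using factors by (auto simp: st0_def valid_def group.is_monoid monoid.one_closed)
  define \<Phi> where "\<Phi> x = fst (foldl step st0 (SOME xs. xs \<in> x))" for x
  have \<Phi>: "\<Phi> (cls xs) = fst (foldl step st0 xs)" if "xs \<in> gp_words V G" for xs
  proof -
    have "xs \<in> cls xs" using that by (auto simp: gp_rel_def intro: gp_cong.refl)
    then have "(SOME ys. ys \<in> cls xs) \<in> cls xs" by (rule someI)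
    then have "gp_cong V E G xs (SOME ys. ys \<in> cls xs)" by (simp add: gp_rel_def)
    from run_cong[OF this st0] show ?thesis by (simp add: \<Phi>_def)
  qed
  have state: "snd (foldl step st0 xs) v = retract v (cls xs)" if "xs \<in> gp_words V G" "v \<in> V" for xs v
    using that(1)
  proof (induction xs rule: rev_induct)
    case Nil
    show ?case using that(2) by (simp add: st0_def cls_nil retract_one)
  next
    case (snoc a xs)
    obtain w g where a: "a = (w, g)" by (cases a)
    have xs: "xs \<in> gp_words V G" "w \<in> V" "g \<in> carrier (G w)"
      using snoc.prems unfolding a snoc_words by auto
    obtain m s where run: "foldl step st0 xs = (m, s)" by (cases "foldl step st0 xs")
    show ?case using snoc.IH[OF xs(1)] xs that(2) cls_closed[OF xs(1)]
      by (simp add: a run step cls_snoc retract_step)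
  qed
  have snoc: "\<Phi> (cls xs \<otimes>\<^bsub>GP\<^esub> incl v g) = \<Phi> (cls xs) \<otimes>\<^bsub>M\<^esub> \<delta> v (retract v (cls xs)) g"
    if xs: "xs \<in> gp_words V G" "v \<in> V" "g \<in> carrier (G v)" for xs v g
  proof -
    have w: "xs @ [(v, g)] \<in> gp_words V G" using xs by (simp add: snoc_words)
    obtain m s where run: "foldl step st0 xs = (m, s)" by (cases "foldl step st0 xs")
    show ?thesis
      using \<Phi>[OF w] \<Phi>[OF xs(1)] state[OF xs(1,2)] by (simp add: cls_snoc[OF xs] run step)
  qed
  show ?thesis
  proof (intro bexI[of _ \<Phi>] conjI ballI)
    show "\<Phi> \<one>\<^bsub>GP\<^esub> = \<one>\<^bsub>M\<^esub>" using \<Phi>[of "[]"] by (simp add: cls_nil st0_def gp_words_def)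
    show "\<Phi> \<in> carrier GP \<rightarrow> carrier M"
    proof
      fix x assume "x \<in> carrier GP"
      then obtain xs where "xs \<in> gp_words V G" "x = cls xs" using carrier_cls by blast
      then show "\<Phi> x \<in> carrier M" using \<Phi> valid_run[OF st0] by (simp add: valid_def)
    qed
    fix x v g assume x: "x \<in> carrier GP" and v: "v \<in> V" "g \<in> carrier (G v)"
    then obtain xs where "xs \<in> gp_words V G" "x = cls xs" using carrier_cls by blast
    then show "\<Phi> (x \<otimes>\<^bsub>GP\<^esub> incl v g) =
       \<Phi> x \<otimes>\<^bsub>M\<^esub> (inv\<^bsub>M\<^esub> (f v (retract v x)) \<otimes>\<^bsub>M\<^esub> f v (retract v x \<otimes>\<^bsub>G v\<^esub> g))"
      using snoc v by (simp add: \<delta>_def)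
  qed
qed

end

text \<open>\<open>\<Phi>\<close> is the map of graph products induced by the maps \<open>f v\<close> of the factors; it intertwines the
  retractions with these maps. It is a homomorphism only if the \<open>f v\<close> are.\<close>
definition gp_lifts ::
  "'v set \<Rightarrow> 'v set set \<Rightarrow> ('v \<Rightarrow> ('a, 'b) monoid_scheme) \<Rightarrow> ('v \<Rightarrow> ('c, 'd) monoid_scheme) \<Rightarrow>
    ('v \<Rightarrow> 'a \<Rightarrow> 'c) \<Rightarrow> (('v \<times> 'a) list set \<Rightarrow> ('v \<times> 'c) list set) \<Rightarrow> bool" where
  "gp_lifts V E G H f \<Phi> \<longleftrightarrow>
     \<Phi> \<in> carrier (graph_product V E G) \<rightarrow> carrier (graph_product V E H) \<and>
     \<Phi> \<one>\<^bsub>graph_product V E G\<^esub> = \<one>\<^bsub>graph_product V E H\<^esub> \<and>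
     (\<forall>x\<in>carrier (graph_product V E G). \<forall>v\<in>V. \<forall>g\<in>carrier (G v).
        \<Phi> (x \<otimes>\<^bsub>graph_product V E G\<^esub> gp_incl V E G v g) =
        \<Phi> x \<otimes>\<^bsub>graph_product V E H\<^esub> gp_incl V E H v
          (inv\<^bsub>H v\<^esub> (f v (gp_retract V E G v x)) \<otimes>\<^bsub>H v\<^esub> f v (gp_retract V E G v x \<otimes>\<^bsub>G v\<^esub> g))) \<and>
     (\<forall>x\<in>carrier (graph_product V E G). \<forall>v\<in>V.
        gp_retract V E H v (\<Phi> x) = f v (gp_retract V E G v x))"

lemma gp_lifts_exists:
  assumes "group_graph V E G" "group_graph V E H"
    and f: "\<And>v. v \<in> V \<Longrightarrow> f v \<in> carrier (G v) \<rightarrow> carrier (H v)"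
    and f1: "\<And>v. v \<in> V \<Longrightarrow> f v \<one>\<^bsub>G v\<^esub> = \<one>\<^bsub>H v\<^esub>"
  shows "\<exists>\<Phi>. gp_lifts V E G H f \<Phi>"
proof -
  interpret G: group_graph V E G by (rule assms)
  interpret H: group_graph V E H by (rule assms)
  have fc: "f v a \<in> carrier (H v)" if "v \<in> V" "a \<in> carrier (G v)" for v a
    using f[OF that(1)] that by auto
  have Gm: "a \<otimes>\<^bsub>G v\<^esub> g \<in> carrier (G v)" if "v \<in> V" "a \<in> carrier (G v)" "g \<in> carrier (G v)" for v a g
    using G.factors[OF that(1)] that by (simp add: group.is_monoid monoid.m_closed)
  have "\<exists>\<Phi>\<in>carrier G.GP \<rightarrow> carrier H.GP. \<Phi> \<one>\<^bsub>G.GP\<^esub> = \<one>\<^bsub>H.GP\<^esub> \<and>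
    (\<forall>x\<in>carrier G.GP. \<forall>v\<in>V. \<forall>g\<in>carrier (G v). \<Phi> (x \<otimes>\<^bsub>G.GP\<^esub> G.incl v g) =
       \<Phi> x \<otimes>\<^bsub>H.GP\<^esub> (inv\<^bsub>H.GP\<^esub> (H.incl v (f v (G.retract v x))) \<otimes>\<^bsub>H.GP\<^esub> H.incl v (f v (G.retract v x \<otimes>\<^bsub>G v\<^esub> g))))"
  proof (rule G.gp_cocycle_exists[where f = "\<lambda>v a. H.incl v (f v a)", OF H.P.is_group])
    show "(\<lambda>a. H.incl v (f v a)) \<in> carrier (G v) \<rightarrow> carrier H.GP" if "v \<in> V" for v
      using that by (auto intro: H.incl_closed fc)
    show "H.incl u (f u g) \<otimes>\<^bsub>H.GP\<^esub> H.incl v (f v h) = H.incl v (f v h) \<otimes>\<^bsub>H.GP\<^esub> H.incl u (f u g)"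
      if "u \<in> V" "v \<in> V" "{u, v} \<in> E" "g \<in> carrier (G u)" "h \<in> carrier (G v)" for u v g h
      by (rule gp_incl_commute[where V=V and E=E and G=H, OF H.factors]) (use that fc in auto)
  qed
  then obtain \<Phi> where \<Phi>: "\<Phi> \<in> carrier G.GP \<rightarrow> carrier H.GP" "\<Phi> \<one>\<^bsub>G.GP\<^esub> = \<one>\<^bsub>H.GP\<^esub>"
    and \<Phi>_step0: "\<And>x v g. x \<in> carrier G.GP \<Longrightarrow> v \<in> V \<Longrightarrow> g \<in> carrier (G v) \<Longrightarrow> \<Phi> (x \<otimes>\<^bsub>G.GP\<^esub> G.incl v g) =
       \<Phi> x \<otimes>\<^bsub>H.GP\<^esub> (inv\<^bsub>H.GP\<^esub> (H.incl v (f v (G.retract v x))) \<otimes>\<^bsub>H.GP\<^esub> H.incl v (f v (G.retract v x \<otimes>\<^bsub>G v\<^esub> g)))"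
    by blast
  have \<Phi>_step: "\<Phi> (x \<otimes>\<^bsub>G.GP\<^esub> G.incl v g) =
       \<Phi> x \<otimes>\<^bsub>H.GP\<^esub> H.incl v (inv\<^bsub>H v\<^esub> (f v (G.retract v x)) \<otimes>\<^bsub>H v\<^esub> f v (G.retract v x \<otimes>\<^bsub>G v\<^esub> g))"
    if x: "x \<in> carrier G.GP" and v: "v \<in> V" "g \<in> carrier (G v)" for x v g
  proof -
    interpret Hv: group "H v" by (rule H.factors[OF v(1)])
    have "G.retract v x \<in> carrier (G v)" by (rule G.retract_closed[OF v(1) x])
    then show ?thesis
      using v by (simp add: \<Phi>_step0[OF x v] H.incl_mult H.incl_inv fc Gm)
  qed
  have "H.retract v (\<Phi> x) = f v (G.retract v x)" if "x \<in> carrier G.GP" "v \<in> V" for x v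
    using that(1)
  proof (induction rule: G.gp_induct)
    case one
    then show ?case using that(2) by (simp add: \<Phi>(2) G.retract_one H.retract_one f1)
  next
    case (step x w g)
    interpret Hv: group "H v" by (rule H.factors[OF that(2)])
    interpret Hw: group "H w" by (rule H.factors[OF step.hyps(2)])
    have r: "G.retract v x \<in> carrier (G v)" "G.retract w x \<in> carrier (G w)"
      using G.retract_closed step that(2) by auto
    have "\<Phi> x \<in> carrier H.GP" using \<Phi>(1) step by auto
    moreover have "inv\<^bsub>H w\<^esub> (f w (G.retract w x)) \<otimes>\<^bsub>H w\<^esub> f w (G.retract w x \<otimes>\<^bsub>G w\<^esub> g) \<in> carrier (H w)"
      using step r by (simp add: fc Gm)
    ultimately show ?case
      using step r that(2)
      by (cases "w = v") (auto simp: \<Phi>_step H.retract_step G.retract_step fc Gm Hv.m_assoc[symmetric])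
  qed
  with \<Phi> \<Phi>_step show ?thesis unfolding gp_lifts_def by blast
qed

text \<open>The letters produced by \<open>\<Phi>\<close> move the state \<open>f(a)\<close> to \<open>f(a g)\<close>, and \<open>\<Psi>\<close> translates this step back into
  a move from \<open>a\<close> to \<open>a g\<close>.\<close>
lemma gp_lifts_left_inverse:
  assumes "group_graph V E G" "group_graph V E H"
    and \<Phi>: "gp_lifts V E G H f \<Phi>" and \<Psi>: "gp_lifts V E H G h \<Psi>"
    and f: "\<And>v. v \<in> V \<Longrightarrow> f v \<in> carrier (G v) \<rightarrow> carrier (H v)"
    and hf: "\<And>v a. v \<in> V \<Longrightarrow> a \<in> carrier (G v) \<Longrightarrow> h v (f v a) = a"
    and x: "x \<in> carrier (graph_product V E G)"
  shows "\<Psi> (\<Phi> x) = x"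
proof -
  interpret G: group_graph V E G by (rule assms)
  interpret H: group_graph V E H by (rule assms)
  show ?thesis
    using x
  proof (induction rule: G.gp_induct)
    case one
    then show ?case using \<Phi> \<Psi> by (simp add: gp_lifts_def)
  next
    case (step x v g)
    interpret Gv: group "G v" by (rule G.factors[OF step.hyps(2)])
    interpret Hv: group "H v" by (rule H.factors[OF step.hyps(2)])
    let ?a = "G.retract v x"
    let ?b = "inv\<^bsub>H v\<^esub> (f v ?a) \<otimes>\<^bsub>H v\<^esub> f v (?a \<otimes>\<^bsub>G v\<^esub> g)"
    have a: "?a \<in> carrier (G v)" using G.retract_closed step by auto
    have fa: "f v ?a \<in> carrier (H v)" "f v (?a \<otimes>\<^bsub>G v\<^esub> g) \<in> carrier (H v)"
      using f[OF step.hyps(2)] a step.hyps(3) by auto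
    have b: "?b \<in> carrier (H v)" using fa by simp
    have ab: "f v ?a \<otimes>\<^bsub>H v\<^esub> ?b = f v (?a \<otimes>\<^bsub>G v\<^esub> g)" using fa by (simp add: Hv.m_assoc[symmetric])
    have \<Phi>x: "\<Phi> x \<in> carrier H.GP" "H.retract v (\<Phi> x) = f v ?a"
      using \<Phi> step unfolding gp_lifts_def by auto
    have "\<Psi> (\<Phi> (x \<otimes>\<^bsub>G.GP\<^esub> G.incl v g)) = \<Psi> (\<Phi> x \<otimes>\<^bsub>H.GP\<^esub> H.incl v ?b)"
      using \<Phi> step unfolding gp_lifts_def by auto
    also have "\<dots> = \<Psi> (\<Phi> x) \<otimes>\<^bsub>G.GP\<^esub> G.incl v (inv\<^bsub>G v\<^esub> (h v (f v ?a)) \<otimes>\<^bsub>G v\<^esub> h v (f v (?a \<otimes>\<^bsub>G v\<^esub> g)))"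
      using \<Psi> step.hyps(2) \<Phi>x b ab unfolding gp_lifts_def by auto
    also have "\<dots> = x \<otimes>\<^bsub>G.GP\<^esub> G.incl v g"
      using step a by (simp add: hf Gv.m_assoc[symmetric])
    finally show ?case .
  qed
qed

text \<open>A right inverse exists along words whose states stay where \<open>f \<circ> h\<close> is the identity. This is how
  elements of the image of \<open>\<Phi>\<close> are recognised.\<close>
lemma gp_lifts_image_step:
  assumes "group_graph V E G" "group_graph V E H"
    and \<Phi>: "gp_lifts V E G H f \<Phi>" and \<Psi>: "gp_lifts V E H G h \<Psi>"
    and h: "\<And>v. v \<in> V \<Longrightarrow> h v \<in> carrier (H v) \<rightarrow> carrier (G v)"
    and y: "y \<in> carrier (graph_product V E H)" "\<Phi> (\<Psi> y) = y"
    and v: "v \<in> V" "g \<in> carrier (H v)"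
    and fh: "f v (h v (gp_retract V E H v y \<otimes>\<^bsub>H v\<^esub> g)) = gp_retract V E H v y \<otimes>\<^bsub>H v\<^esub> g"
  shows "\<Phi> (\<Psi> (y \<otimes>\<^bsub>graph_product V E H\<^esub> gp_incl V E H v g)) =
    y \<otimes>\<^bsub>graph_product V E H\<^esub> gp_incl V E H v g"
proof -
  interpret G: group_graph V E G by (rule assms)
  interpret H: group_graph V E H by (rule assms)
  interpret Gv: group "G v" by (rule G.factors[OF v(1)])
  interpret Hv: group "H v" by (rule H.factors[OF v(1)])
  let ?a = "H.retract v y"
  let ?b = "inv\<^bsub>G v\<^esub> (h v ?a) \<otimes>\<^bsub>G v\<^esub> h v (?a \<otimes>\<^bsub>H v\<^esub> g)"
  have a: "?a \<in> carrier (H v)" using H.retract_closed y v by auto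
  have ha: "h v ?a \<in> carrier (G v)" "h v (?a \<otimes>\<^bsub>H v\<^esub> g) \<in> carrier (G v)"
    using h[OF v(1)] a v by auto
  have b: "?b \<in> carrier (G v)" using ha by simp
  have ab: "h v ?a \<otimes>\<^bsub>G v\<^esub> ?b = h v (?a \<otimes>\<^bsub>H v\<^esub> g)" using ha by (simp add: Gv.m_assoc[symmetric])
  have \<Psi>y: "\<Psi> y \<in> carrier G.GP" "G.retract v (\<Psi> y) = h v ?a"
    using \<Psi> y v unfolding gp_lifts_def by auto
  have fha: "f v (h v ?a) = ?a"
    using \<Phi> \<Psi>y y(2) v unfolding gp_lifts_def by auto
  have "\<Phi> (\<Psi> (y \<otimes>\<^bsub>H.GP\<^esub> H.incl v g)) = \<Phi> (\<Psi> y \<otimes>\<^bsub>G.GP\<^esub> G.incl v ?b)"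
    using \<Psi> y v unfolding gp_lifts_def by auto
  also have "\<dots> = \<Phi> (\<Psi> y) \<otimes>\<^bsub>H.GP\<^esub> H.incl v (inv\<^bsub>H v\<^esub> (f v (h v ?a)) \<otimes>\<^bsub>H v\<^esub> f v (h v (?a \<otimes>\<^bsub>H v\<^esub> g)))"
    using \<Phi> v \<Psi>y b ab unfolding gp_lifts_def by auto
  also have "\<dots> = y \<otimes>\<^bsub>H.GP\<^esub> H.incl v g"
    using v a by (simp add: fha fh y(2) Hv.m_assoc[symmetric])
  finally show ?thesis .
qed

section \<open>Exponentially many elements over two non-adjacent vertices\<close>

text \<open>For non-adjacent \<open>u\<close> and \<open>v\<close> the graph product of these groups is the free product of cyclic groups of
  orders 2 and 3, the modular group \<open>PSL(2, \<int>)\<close>; all other factors are trivial.\<close>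
definition modular_factors :: "'v \<Rightarrow> 'v \<Rightarrow> 'v \<Rightarrow> int monoid" where
  "modular_factors u v w = integer_mod_group (if w = u then 2 else if w = v then 3 else 1)"

text \<open>The words in \<open>b a\<close> and \<open>b\<^sup>2 a\<close>, where \<open>a\<close> and \<open>b\<close> are the generators of orders 2 and 3. These two elements
  generate a free monoid.\<close>
definition modular_word :: "'v set \<Rightarrow> 'v set set \<Rightarrow> 'v \<Rightarrow> 'v \<Rightarrow> bool list \<Rightarrow> ('v \<times> int) list set" where
  "modular_word V E u v cs = foldr (\<lambda>c x.
     gp_incl V E (modular_factors u v) v (if c then 1 else 2) \<otimes>\<^bsub>graph_product V E (modular_factors u v)\<^esub>
     gp_incl V E (modular_factors u v) u 1 \<otimes>\<^bsub>graph_product V E (modular_factors u v)\<^esub> x)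
     cs \<one>\<^bsub>graph_product V E (modular_factors u v)\<^esub>"

lemma carrier_BijGroup_UNIV: "carrier (BijGroup UNIV) = Collect bij"
  by (auto simp: BijGroup_def Bij_def extensional_def)

lemma mult_BijGroup_UNIV: "bij p \<Longrightarrow> bij q \<Longrightarrow> p \<otimes>\<^bsub>BijGroup UNIV\<^esub> q = p \<circ> q"
  by (simp add: BijGroup_def Bij_def extensional_def compose_def fun_eq_iff)

lemma bij_of_order:
  assumes "\<And>x. (p ^^ n) x = x" "n > 0"
  shows "bij (p :: 'x \<Rightarrow> 'x)"
proof -
  obtain m where m: "n = Suc m" using assms(2) gr0_implies_Suc by blast
  show ?thesis
  proof (rule o_bij)
    show "(p ^^ m) \<circ> p = id" using assms(1) by (auto simp: m fun_eq_iff funpow_swap1)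
    show "p \<circ> (p ^^ m) = id" using assms(1) by (auto simp: m fun_eq_iff)
  qed
qed

lemma funpow_hom_BijGroup:
  assumes p: "\<And>x. (p ^^ n) x = x" and n: "n > 0"
  shows "(\<lambda>t. p ^^ nat t) \<in> hom (integer_mod_group n) (BijGroup UNIV)"
proof (rule homI)
  have bij: "bij (p ^^ k)" for k using bij_of_order[OF p n] by (rule bij_fn)
  then show "p ^^ nat t \<in> carrier (BijGroup UNIV)" for t by (simp add: carrier_BijGroup_UNIV)
  fix s t assume "s \<in> carrier (integer_mod_group n)" "t \<in> carrier (integer_mod_group n)"
  then have "0 \<le> s" "0 \<le> t" using n by (auto simp: carrier_integer_mod_group)
  then have "nat ((s + t) mod int n) = (nat s + nat t) mod n"
    by (simp add: nat_mod_distrib nat_add_distrib)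
  then have "p ^^ nat ((s + t) mod int n) = (p ^^ nat s) \<circ> (p ^^ nat t)"
    using funpow_mod_eq[OF p] by (simp add: fun_eq_iff funpow_add)
  then show "p ^^ nat (s \<otimes>\<^bsub>integer_mod_group n\<^esub> t) = (p ^^ nat s) \<otimes>\<^bsub>BijGroup UNIV\<^esub> (p ^^ nat t)"
    by (simp add: mult_BijGroup_UNIV bij)
qed

text \<open>The standard generators \<open>x \<mapsto> - 1 / x\<close> and \<open>x \<mapsto> 1 - 1 / x\<close> of the modular group act on the projective
  line. To act on the reals, which lack the point at infinity, they are changed at the exceptional points:
  \<open>0\<close> is fixed by the first because \<open>inverse 0 = 0\<close>, and the second, which would permute \<open>\<infinity>, 1, 0\<close>
  cyclically, is made to fix \<open>0\<close> and \<open>1\<close>. The orders 2 and 3 are preserved, and nothing changes along the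
  orbits of positive numbers that are followed below.\<close>
definition half_turn :: "real \<Rightarrow> real" where "half_turn x = - inverse x"

definition third_turn :: "real \<Rightarrow> real" where
  "third_turn x = (if x = 0 \<or> x = 1 then x else 1 - inverse x)"

lemma half_turn_order: "(half_turn ^^ 2) x = x"
  by (simp add: half_turn_def numeral_2_eq_2)

lemma third_turn_order: "(third_turn ^^ 3) x = x"
proof (cases "x = 0 \<or> x = 1")
  case False
  have 1: "third_turn x = (x - 1) / x" using False by (simp add: third_turn_def field_simps)
  have 2: "third_turn ((x - 1) / x) = - 1 / (x - 1)"
    using False by (simp add: third_turn_def field_simps)
  have 3: "third_turn (- 1 / (x - 1)) = x"
    using False by (auto simp: third_turn_def field_simps)
  show ?thesis by (simp only: numeral_3_eq_3 funpow.simps o_apply id_apply 1 2 3)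
qed (auto simp: third_turn_def numeral_3_eq_3)

text \<open>The images of \<open>1\<close> under the words in \<open>b a\<close> and \<open>b\<^sup>2 a\<close>, which act on positive numbers by \<open>x \<mapsto> 1 + x\<close> and
  \<open>x \<mapsto> x / (1 + x)\<close>. These are the entries of the Calkin-Wilf tree.\<close>
primrec calkin_wilf :: "bool list \<Rightarrow> real" where
  "calkin_wilf [] = 1"
| "calkin_wilf (c # cs) = (if c then 1 + calkin_wilf cs else calkin_wilf cs / (1 + calkin_wilf cs))"

lemma calkin_wilf_pos: "calkin_wilf cs > 0"
  by (induction cs) (auto intro!: divide_pos_pos add_pos_pos)

text \<open>The first letter of a word can be read off from its value, which is greater than \<open>1\<close> in one case and
  less than \<open>1\<close> in the other.\<close>
lemma inj_calkin_wilf: "length cs = length ds \<Longrightarrow> calkin_wilf cs = calkin_wilf ds \<Longrightarrow> cs = ds"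
proof (induction cs ds rule: list_induct2)
  case (Cons c cs d ds)
  have lt: "x / (1 + x) < 1 + y" if "x > 0" "y > 0" for x y :: real
    using that by (simp add: divide_less_eq) (simp add: algebra_simps add_pos_pos)
  have inj: "x = y" if "x / (1 + x) = y / (1 + y)" "x > 0" "y > 0" for x y :: real
    using that by (simp add: field_simps)
  from Cons.prems have "c = d \<and> calkin_wilf cs = calkin_wilf ds"
    using calkin_wilf_pos[of cs] calkin_wilf_pos[of ds]
      lt[of "calkin_wilf cs" "calkin_wilf ds"] lt[of "calkin_wilf ds" "calkin_wilf cs"]
      inj[of "calkin_wilf cs" "calkin_wilf ds"]
    by (auto split: if_splits)
  with Cons.IH show ?case by simp
qed simp

lemma group_graph_modular: "simple_graph V E \<Longrightarrow> group_graph V E (modular_factors u v)"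
  by (simp add: group_graph_def modular_factors_def)

lemma modular_generators:
  assumes "u \<noteq> v"
  shows "1 \<in> carrier (modular_factors u v u)" "(if c then 1 else 2) \<in> carrier (modular_factors u v v)"
  using assms by (auto simp: modular_factors_def carrier_integer_mod_group)

lemma modular_word_Cons:
  "modular_word V E u v (c # cs) =
     gp_incl V E (modular_factors u v) v (if c then 1 else 2) \<otimes>\<^bsub>graph_product V E (modular_factors u v)\<^esub>
     gp_incl V E (modular_factors u v) u 1 \<otimes>\<^bsub>graph_product V E (modular_factors u v)\<^esub> modular_word V E u v cs"
  by (simp add: modular_word_def)

lemma modular_word_closed:
  assumes "simple_graph V E" "u \<in> V" "v \<in> V" "u \<noteq> v"
  shows "modular_word V E u v cs \<in> carrier (graph_product V E (modular_factors u v))"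
proof -
  interpret K: group_graph V E "modular_factors u v" by (rule group_graph_modular[OF assms(1)])
  note g = modular_generators[OF assms(4)]
  show ?thesis
  proof (induction cs)
    case (Cons c cs)
    then show ?case
      unfolding modular_word_Cons
      by (intro K.P.m_closed K.incl_closed g assms(2,3))
  qed (simp add: modular_word_def)
qed

lemma inj_on_modular_word:
  assumes simple: "simple_graph V E" and uv: "u \<in> V" "v \<in> V" "u \<noteq> v" "{u, v} \<notin> E"
  shows "inj_on (modular_word V E u v) {cs. length cs = m}"
proof -
  let ?B = "BijGroup (UNIV :: real set)"
  interpret K: group_graph V E "modular_factors u v" by (rule group_graph_modular[OF simple])
  define p where "p w = (if w = u then half_turn else if w = v then third_turn else id)" for w
  have p_order: "(p w ^^ (if w = u then 2 else if w = v then 3 else 1)) x = x" for w x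
    using half_turn_order third_turn_order by (auto simp: p_def)
  have hom: "(\<lambda>t. p w ^^ nat t) \<in> hom (modular_factors u v w) ?B" for w
    unfolding modular_factors_def by (rule funpow_hom_BijGroup[OF p_order]) auto
  have bij: "bij (p w ^^ k)" for w k
    by (rule bij_fn, rule bij_of_order[OF p_order]) auto
  have comm: "(p a ^^ nat s) \<otimes>\<^bsub>?B\<^esub> (p b ^^ nat t) = (p b ^^ nat t) \<otimes>\<^bsub>?B\<^esub> (p a ^^ nat s)"
    if "{a, b} \<in> E" for a b s t
  proof -
    have "a \<noteq> b" by (rule K.edge_neq[OF that])
    then have "p a = id \<or> p b = id" using that uv(4) by (auto simp: p_def insert_commute)
    moreover have "(id ^^ k) = (id :: real \<Rightarrow> real)" for k by (induction k) auto
    ultimately show ?thesis by (auto simp: mult_BijGroup_UNIV bij)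
  qed
  obtain \<chi> where \<chi>: "\<chi> \<in> hom K.GP ?B"
    and \<chi>_incl: "\<And>w t. w \<in> V \<Longrightarrow> t \<in> carrier (modular_factors u v w) \<Longrightarrow> \<chi> (K.incl w t) = p w ^^ nat t"
    using gp_hom_exists[where V=V and E=E and G="modular_factors u v" and H="?B" and f="\<lambda>w t. p w ^^ nat t",
        OF K.factors group_BijGroup hom comm] by auto
  have \<chi>_bij: "bij (\<chi> x)" if "x \<in> carrier K.GP" for x
    using \<chi> that by (auto simp: hom_def carrier_BijGroup_UNIV)
  have \<chi>_mult: "\<chi> (x \<otimes>\<^bsub>K.GP\<^esub> y) = \<chi> x \<circ> \<chi> y" if "x \<in> carrier K.GP" "y \<in> carrier K.GP" for x y
    using hom_mult[OF \<chi> that] \<chi>_bij that by (simp add: mult_BijGroup_UNIV)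
  note g = modular_generators[OF uv(3)]
  have "\<chi> (modular_word V E u v cs) 1 = calkin_wilf cs" for cs
  proof (induction cs)
    case Nil
    have "\<chi> \<one>\<^bsub>K.GP\<^esub> = \<one>\<^bsub>?B\<^esub>" by (rule hom_one[OF \<chi> K.P.is_group group_BijGroup])
    then show ?case by (simp add: modular_word_def BijGroup_def)
  next
    case (Cons c cs)
    let ?x = "calkin_wilf cs"
    have pos: "?x > 0" by (rule calkin_wilf_pos)
    have "\<chi> (modular_word V E u v (c # cs)) 1 = (third_turn ^^ (if c then 1 else 2)) (half_turn ?x)"
      using Cons.IH g(1) g(2)[of c] uv modular_word_closed[OF simple uv(1-3), of cs]
      by (simp add: modular_word_Cons \<chi>_mult \<chi>_incl K.incl_closed p_def split: if_splits)
    also have "\<dots> = calkin_wilf (c # cs)"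
    proof -
      have a: "third_turn (half_turn ?x) = 1 + ?x"
        using pos by (auto simp: third_turn_def half_turn_def field_simps)
      have b: "third_turn (1 + ?x) = ?x / (1 + ?x)"
        using pos by (auto simp: third_turn_def field_simps)
      show ?thesis using a b by (simp add: numeral_2_eq_2)
    qed
    finally show ?case .
  qed
  then show ?thesis by (intro inj_onI) (metis inj_calkin_wilf mem_Collect_eq)
qed

section \<open>Word metrics on graph products of finite groups\<close>

lemma (in group_graph) finite_generating_set_factors:
  assumes "finite V" "\<And>v. v \<in> V \<Longrightarrow> finite (carrier (G v))"
  shows "finite_generating_set GP (\<Union>v\<in>V. incl v ` carrier (G v))" (is "finite_generating_set GP ?T")
proof -
  have sub: "?T \<subseteq> carrier GP" using incl_closed by auto
  have "x \<in> generate GP ?T" if "x \<in> carrier GP" for x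
    using that
  proof (induction rule: gp_induct)
    case (step x v g)
    then show ?case by (intro generate.eng[OF step.IH] generate.incl) auto
  qed (rule generate.one)
  moreover have "generate GP ?T \<subseteq> carrier GP" by (rule P.generate_incl[OF sub])
  ultimately show ?thesis using assms sub by (auto simp: finite_generating_set_def)
qed

text \<open>Along an edge of the source the image is multiplied from the right by some \<open>f(a)\<^sup>-\<^sup>1 f(b)\<close>, so it is
  enough to bound the lengths of these elements.\<close>
lemma gp_lifts_lipschitz:
  assumes GG: "group_graph V E G" "group_graph V E H"
    and \<Phi>: "gp_lifts V E G H f \<Phi>"
    and f: "\<And>v. v \<in> V \<Longrightarrow> f v \<in> carrier (G v) \<rightarrow> carrier (H v)"
    and fin: "finite V" "\<And>v. v \<in> V \<Longrightarrow> finite (carrier (G v))"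
    and S: "finite_generating_set (graph_product V E H) S"
    and A: "\<And>v a b. v \<in> V \<Longrightarrow> a \<in> carrier (G v) \<Longrightarrow> b \<in> carrier (G v) \<Longrightarrow>
      cayley_dist (graph_product V E H) S \<one>\<^bsub>graph_product V E H\<^esub>
        (gp_incl V E H v (inv\<^bsub>H v\<^esub> (f v a) \<otimes>\<^bsub>H v\<^esub> f v b)) \<le> A"
    and xy: "x \<in> carrier (graph_product V E G)" "y \<in> carrier (graph_product V E G)"
  shows "cayley_dist (graph_product V E H) S (\<Phi> x) (\<Phi> y) \<le>
    A * cayley_dist (graph_product V E G) (\<Union>v\<in>V. gp_incl V E G v ` carrier (G v)) x y"
proof -
  interpret G: group_graph V E G by (rule GG)
  interpret H: group_graph V E H by (rule GG)
  interpret CG: cayley_graph G.GP "\<Union>v\<in>V. G.incl v ` carrier (G v)"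
    by unfold_locales (rule G.finite_generating_set_factors[OF fin])
  interpret CH: cayley_graph H.GP S by unfold_locales (rule S)
  have \<Phi>c: "\<Phi> x \<in> carrier H.GP" if "x \<in> carrier G.GP" for x
    using \<Phi> that unfolding gp_lifts_def by auto
  show ?thesis
  proof (rule CG.lipschitz_from_generators[where Y = "carrier H.GP" and d = CH.cdist])
    fix x s assume x: "x \<in> carrier G.GP" and "s \<in> (\<Union>v\<in>V. G.incl v ` carrier (G v))"
    then obtain v g where v: "v \<in> V" "g \<in> carrier (G v)" "s = G.incl v g" by auto
    interpret Gv: group "G v" by (rule G.factors[OF v(1)])
    interpret Hv: group "H v" by (rule H.factors[OF v(1)])
    let ?a = "G.retract v x"
    let ?i = "H.incl v (inv\<^bsub>H v\<^esub> (f v ?a) \<otimes>\<^bsub>H v\<^esub> f v (?a \<otimes>\<^bsub>G v\<^esub> g))"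
    have a: "?a \<in> carrier (G v)" by (rule G.retract_closed[OF v(1) x])
    have i: "?i \<in> carrier H.GP"
      using f[OF v(1)] a v by (intro H.incl_closed) auto
    have "\<Phi> (x \<otimes>\<^bsub>G.GP\<^esub> s) = \<Phi> x \<otimes>\<^bsub>H.GP\<^esub> ?i"
      using \<Phi> x v unfolding gp_lifts_def by auto
    then have "CH.cdist (\<Phi> x) (\<Phi> (x \<otimes>\<^bsub>G.GP\<^esub> s)) = CH.cdist \<one>\<^bsub>H.GP\<^esub> ?i"
      using CH.cdist_translate[OF \<Phi>c[OF x] H.P.one_closed i] \<Phi>c[OF x] by simp
    also have "\<dots> \<le> A" using A[OF v(1) a, of "?a \<otimes>\<^bsub>G v\<^esub> g"] a v by simp
    finally show "CH.cdist (\<Phi> x) (\<Phi> (x \<otimes>\<^bsub>G.GP\<^esub> s)) \<le> A" .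
  next
    show "\<Phi> \<in> carrier G.GP \<rightarrow> carrier H.GP" using \<Phi>c by auto
  qed (use xy in \<open>auto intro: CH.cdist_triangle CH.cdist_sym\<close>)
qed

section \<open>Finite windows in the factors\<close>

lemma superset_of_card:
  assumes "infinite C" "finite F" "F \<subseteq> C" "card F \<le> n"
  shows "\<exists>F'. finite F' \<and> F \<subseteq> F' \<and> F' \<subseteq> C \<and> card F' = n"
proof -
  have "infinite (C - F)" using assms(1,2) by simp
  then obtain T where T: "finite T" "card T = n - card F" "T \<subseteq> C - F"
    using infinite_arbitrarily_large by blast
  have "card (F \<union> T) = card F + card T" using T assms(2) by (intro card_Un_disjoint) auto
  with T assms show ?thesis by (intro exI[of _ "F \<union> T"]) auto
qed

text \<open>A window of exactly \<open>n\<close> elements containing \<open>F\<close>, labelled by \<open>0, \<dots>, n - 1\<close> so that the distinguished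
  element gets the label \<open>0\<close>; \<open>h\<close> reads off the labels.\<close>
lemma cyclic_labelling:
  assumes "infinite C" "finite F" "F \<subseteq> C" "e \<in> F" "card F \<le> n"
  shows "\<exists>f h. f \<in> {0..<int n} \<rightarrow> C \<and> h \<in> C \<rightarrow> {0..<int n} \<and> f 0 = e \<and> h e = 0 \<and>
    (\<forall>a\<in>{0..<int n}. h (f a) = a) \<and> F \<subseteq> f ` {0..<int n}"
proof -
  obtain F' where F': "finite F'" "F \<subseteq> F'" "F' \<subseteq> C" "card F' = n"
    using superset_of_card[OF assms(1-3,5)] by blast
  have e: "e \<in> F'" using F' assms(4) by auto
  then have n: "n > 0" using F' by (metis card_gt_0_iff empty_iff)
  have "card {1..<int n} = card (F' - {e})" using F' e by simp
  then obtain f0 where f0: "bij_betw f0 {1..<int n} (F' - {e})"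
    using F'(1) finite_same_card_bij by blast
  define f where "f = f0(0 := e)"
  have "{0..<int n} = insert 0 {1..<int n}" using n by auto
  moreover have "bij_betw f (insert 0 {1..<int n}) (insert e (F' - {e}))"
  proof -
    have "bij_betw f {1..<int n} (F' - {e})"
      using f0 by (rule bij_betw_cong[THEN iffD1, rotated]) (auto simp: f_def)
    then have "bij_betw f ({1..<int n} \<union> {0}) ((F' - {e}) \<union> {f 0})"
      by (subst notIn_Un_bij_betw3[symmetric]) (auto simp: f_def)
    then show ?thesis by (simp add: f_def)
  qed
  moreover have "insert e (F' - {e}) = F'" using e by auto
  ultimately have f: "bij_betw f {0..<int n} F'" by simp
  define h where "h g = (if g \<in> F' then the_inv_into {0..<int n} f g else 0)" for g
  have hf: "h (f a) = a" if "a \<in> {0..<int n}" for a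
    using that f by (auto simp: h_def bij_betw_def the_inv_into_f_f)
  have f0e: "f 0 = e" by (simp add: f_def)
  show ?thesis
  proof (intro exI conjI)
    show "f \<in> {0..<int n} \<rightarrow> C" using f F' by (auto simp: bij_betw_def)
    show "h \<in> C \<rightarrow> {0..<int n}"
    proof
      fix g
      show "h g \<in> {0..<int n}"
      proof (cases "g \<in> F'")
        case True
        then obtain a where "a \<in> {0..<int n}" "g = f a" using f by (auto simp: bij_betw_def)
        then show ?thesis using hf by simp
      qed (use n in \<open>simp add: h_def\<close>)
    qed
    show "h e = 0" using hf[of 0] n f0e by simp
    show "\<forall>a\<in>{0..<int n}. h (f a) = a" using hf by blast
    show "F \<subseteq> f ` {0..<int n}" using f F' by (auto simp: bij_betw_def)
  qed (rule f0e)
qed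

text \<open>The windows are the images of the labellings \<open>f v\<close>; \<open>\<phi>\<close> and \<open>\<psi>\<close> are the maps of graph products induced by
  the labellings and by their left inverses. The constant \<open>A\<close> bounds the lengths of quotients of two elements
  of a window, and is therefore a Lipschitz constant for every induced map with values in the windows.\<close>
locale gp_window = group_graph V E G
  for V :: "'v set" and E :: "'v set set" and G :: "'v \<Rightarrow> ('a, 'b) monoid_scheme" +
  fixes n :: nat and f :: "'v \<Rightarrow> int \<Rightarrow> 'a" and h :: "'v \<Rightarrow> 'a \<Rightarrow> int"
    and \<phi> :: "('v \<times> int) list set \<Rightarrow> ('v \<times> 'a) list set"
    and \<psi> :: "('v \<times> 'a) list set \<Rightarrow> ('v \<times> int) list set"
    and S :: "('v \<times> 'a) list set set" and A :: real
  assumes finV: "finite V" and n: "n \<ge> 3"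
    and f: "\<And>v. v \<in> V \<Longrightarrow> f v \<in> {0..<int n} \<rightarrow> carrier (G v)"
    and h: "\<And>v. v \<in> V \<Longrightarrow> h v \<in> carrier (G v) \<rightarrow> {0..<int n}"
    and f_zero: "\<And>v. v \<in> V \<Longrightarrow> f v 0 = \<one>\<^bsub>G v\<^esub>"
    and hf: "\<And>v a. v \<in> V \<Longrightarrow> a \<in> {0..<int n} \<Longrightarrow> h v (f v a) = a"
    and \<phi>: "gp_lifts V E (\<lambda>_. integer_mod_group n) G f \<phi>"
    and \<psi>: "gp_lifts V E G (\<lambda>_. integer_mod_group n) h \<psi>"
    and S: "finite_generating_set (graph_product V E G) S"
    and A_pos: "A > 0"
    and A: "\<And>v a b. v \<in> V \<Longrightarrow> a \<in> f v ` {0..<int n} \<Longrightarrow> b \<in> f v ` {0..<int n} \<Longrightarrow>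
      cayley_dist (graph_product V E G) S \<one>\<^bsub>graph_product V E G\<^esub>
        (gp_incl V E G v (inv\<^bsub>G v\<^esub> a \<otimes>\<^bsub>G v\<^esub> b)) \<le> A"
begin

abbreviation window :: "'v \<Rightarrow> 'a set" where "window v \<equiv> f v ` {0..<int n}"
abbreviation QP :: "('v \<times> int) list set monoid" where
  "QP \<equiv> graph_product V E (\<lambda>_. integer_mod_group n)"
abbreviation T :: "('v \<times> int) list set set" where
  "T \<equiv> \<Union>v\<in>V. gp_incl V E (\<lambda>_. integer_mod_group n) v ` carrier (integer_mod_group n)"

sublocale Q: group_graph V E "\<lambda>_. integer_mod_group n"
  by (simp add: group_graph_def simple)

sublocale CP: cayley_graph "graph_product V E G" S
  by unfold_locales (rule S)

lemma carrier_Zn: "carrier (integer_mod_group n) = {0..<int n}"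
  using n by (simp add: carrier_integer_mod_group)

sublocale CQ: cayley_graph "graph_product V E (\<lambda>_. integer_mod_group n)" T
  by unfold_locales (rule Q.finite_generating_set_factors[OF finV], simp add: carrier_Zn)

lemma window_sub: "v \<in> V \<Longrightarrow> window v \<subseteq> carrier (G v)"
  using f by auto

lemma one_window: "v \<in> V \<Longrightarrow> \<one>\<^bsub>G v\<^esub> \<in> window v"
  using f_zero[of v] n by (intro image_eqI[of _ _ 0]) auto

lemma fh: "v \<in> V \<Longrightarrow> a \<in> window v \<Longrightarrow> f v (h v a) = a"
  using hf by auto

lemma \<phi>_closed: "x \<in> carrier QP \<Longrightarrow> \<phi> x \<in> carrier GP"
  using \<phi> unfolding gp_lifts_def by auto

lemma \<psi>_\<phi>: "x \<in> carrier QP \<Longrightarrow> \<psi> (\<phi> x) = x"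
  by (rule gp_lifts_left_inverse[OF Q.group_graph_axioms group_graph_axioms \<phi> \<psi>])
    (use f hf in \<open>auto simp: carrier_Zn\<close>)

lemma inj_\<phi>: "inj_on \<phi> (carrier QP)"
  by (rule inj_on_inverseI) (rule \<psi>_\<phi>)

lemma in_image_iff: "y \<in> \<phi> ` carrier QP \<longleftrightarrow> y \<in> carrier GP \<and> \<phi> (\<psi> y) = y"
proof
  assume y: "y \<in> carrier GP \<and> \<phi> (\<psi> y) = y"
  then have "\<psi> y \<in> carrier QP" using \<psi> unfolding gp_lifts_def by auto
  with y show "y \<in> \<phi> ` carrier QP" by (metis image_eqI)
qed (auto simp: \<phi>_closed \<psi>_\<phi>)

lemma one_image: "\<one>\<^bsub>GP\<^esub> \<in> \<phi> ` carrier QP"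
  using \<phi> Q.P.one_closed unfolding gp_lifts_def by (metis image_eqI)

text \<open>By induction along words, an element belongs to the image of \<open>\<phi>\<close> as soon as it can be reached by a word
  whose states stay in the windows.\<close>
lemma image_step:
  assumes "y \<in> \<phi> ` carrier QP" "v \<in> V" "g \<in> carrier (G v)" "retract v y \<otimes>\<^bsub>G v\<^esub> g \<in> window v"
  shows "y \<otimes>\<^bsub>GP\<^esub> incl v g \<in> \<phi> ` carrier QP"
  using assms gp_lifts_image_step[OF Q.group_graph_axioms group_graph_axioms \<phi> \<psi>, of y v g] h fh
  unfolding in_image_iff by (auto simp: incl_closed carrier_Zn)

lemma \<phi>_lipschitz:
  assumes "x \<in> carrier QP" "y \<in> carrier QP"
  shows "CP.cdist (\<phi> x) (\<phi> y) \<le> A * CQ.cdist x y"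
  by (rule gp_lifts_lipschitz[OF Q.group_graph_axioms group_graph_axioms \<phi> _ finV _ S A assms])
    (use f in \<open>auto simp: carrier_Zn\<close>)

text \<open>The copy of the modular group in \<open>P\<close> induced by sending the factor of order 2 to \<open>{1, s}\<close> and the factor
  of order 3 to three elements of the window at \<open>v\<close> lies in \<open>\<phi>(Q)\<close>. It also lies in \<open>s \<phi>(Q)\<close>: after
  multiplication by \<open>s\<^sup>-\<^sup>1\<close> from the left, the states at \<open>u\<close> become \<open>{s\<^sup>-\<^sup>1, 1}\<close>, which is still inside the
  window, and the other states are unchanged. Each letter pair of a modular word costs length \<open>2\<close>, hence
  the constant \<open>2 A\<close>.\<close>
lemma overlap_translate:
  assumes p: "p \<in> carrier GP" and uv: "u \<in> V" "v \<in> V" "u \<noteq> v" "{u, v} \<notin> E"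
    and s: "s \<in> window u" "inv\<^bsub>G u\<^esub> s \<in> window u" "s \<noteq> \<one>\<^bsub>G u\<^esub>"
  shows "exp_overlap CP.cdist (2 * A) ((\<lambda>y. p \<otimes>\<^bsub>GP\<^esub> y) ` \<phi> ` carrier QP)
    ((\<lambda>y. p \<otimes>\<^bsub>GP\<^esub> incl u s \<otimes>\<^bsub>GP\<^esub> y) ` \<phi> ` carrier QP)"
    (is "exp_overlap _ _ ?Y ?Y'")
proof -
  let ?K = "modular_factors u v"
  interpret K: group_graph V E ?K by (rule group_graph_modular[OF simple])
  interpret Gu: group "G u" by (rule factors[OF uv(1)])
  interpret Gv: group "G v" by (rule factors[OF uv(2)])
  have finK: "finite (carrier (?K w))" for w
    by (auto simp: modular_factors_def carrier_integer_mod_group)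
  have sc: "s \<in> carrier (G u)" using s(1) window_sub uv by blast
  have b: "f v 1 \<in> window v" "f v 2 \<in> window v" "f v 1 \<noteq> \<one>\<^bsub>G v\<^esub>" "f v 2 \<noteq> \<one>\<^bsub>G v\<^esub>" "f v 1 \<noteq> f v 2"
    using n hf[OF uv(2), of 0] hf[OF uv(2), of 1] hf[OF uv(2), of 2] f_zero[OF uv(2)] by auto
  define \<theta> where "\<theta> w t = (if w = u then if t = (0::int) then \<one>\<^bsub>G u\<^esub> else s else
    if w = v then if t = 0 then \<one>\<^bsub>G v\<^esub> else f v t else \<one>\<^bsub>G w\<^esub>)" for w t
  define \<eta> where "\<eta> w g = (if w = u then if g = \<one>\<^bsub>G u\<^esub> then 0 else 1 else
    if w = v then if g = \<one>\<^bsub>G v\<^esub> then 0 else if g = f v 1 then 1 else 2 else (0::int))" for w g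
  have carr: "t \<in> carrier (?K w) \<longleftrightarrow> (if w = u then t = 0 \<or> t = 1 else if w = v then t = 0 \<or> t = 1 \<or> t = 2 else t = 0)" for w t
    by (auto simp: modular_factors_def carrier_integer_mod_group)
  have \<theta>w: "\<theta> w t \<in> window w" if "w \<in> V" "t \<in> carrier (?K w)" for w t
    using that s(1) b one_window uv by (auto simp: \<theta>_def carr split: if_splits)
  have \<theta>c: "\<theta> w \<in> carrier (?K w) \<rightarrow> carrier (G w)" if "w \<in> V" for w
    using \<theta>w window_sub that by blast
  have \<eta>c: "\<eta> w \<in> carrier (G w) \<rightarrow> carrier (?K w)" for w
    by (auto simp: \<eta>_def carr)
  have \<theta>1: "\<theta> w \<one>\<^bsub>?K w\<^esub> = \<one>\<^bsub>G w\<^esub>" for w by (auto simp: \<theta>_def modular_factors_def)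
  have \<eta>1: "\<eta> w \<one>\<^bsub>G w\<^esub> = \<one>\<^bsub>?K w\<^esub>" for w by (auto simp: \<eta>_def modular_factors_def)
  have \<eta>\<theta>: "\<eta> w (\<theta> w t) = t" if "t \<in> carrier (?K w)" for w t
    using that s(3) b uv(3) by (auto simp: \<theta>_def \<eta>_def carr split: if_splits)
  obtain \<Theta> where \<Theta>: "gp_lifts V E ?K G \<theta> \<Theta>"
    using gp_lifts_exists[OF K.group_graph_axioms group_graph_axioms, of \<theta>] \<theta>c \<theta>1 by auto
  obtain \<Xi> where \<Xi>: "gp_lifts V E G ?K \<eta> \<Xi>"
    using gp_lifts_exists[OF group_graph_axioms K.group_graph_axioms, of \<eta>] \<eta>c \<eta>1 by auto
  have \<Theta>c: "\<Theta> x \<in> carrier GP" if "x \<in> carrier K.GP" for x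
    using \<Theta> that unfolding gp_lifts_def by auto
  have \<Theta>1: "\<Theta> \<one>\<^bsub>K.GP\<^esub> = \<one>\<^bsub>GP\<^esub>" using \<Theta> unfolding gp_lifts_def by auto
  have \<Theta>_retract: "retract w (\<Theta> x) = \<theta> w (K.retract w x)" if "x \<in> carrier K.GP" "w \<in> V" for x w
    using \<Theta> that unfolding gp_lifts_def by auto
  have "\<Xi> (\<Theta> x) = x" if "x \<in> carrier K.GP" for x
    by (rule gp_lifts_left_inverse[OF K.group_graph_axioms group_graph_axioms \<Theta> \<Xi> \<theta>c \<eta>\<theta> that])
  then have inj_\<Theta>: "inj_on \<Theta> (carrier K.GP)" by (rule inj_on_inverseI)

  \<comment> \<open>A translate of the modular copy lies in the image of \<open>\<phi>\<close> if its states, shifted by those of \<open>q\<close>, stay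
    in the windows. This is applied to \<open>q = 1\<close> and to \<open>q = s\<^sup>-\<^sup>1\<close>.\<close>
  have \<Theta>_image: "q \<otimes>\<^bsub>GP\<^esub> \<Theta> x \<in> \<phi> ` carrier QP"
    if q: "q \<in> \<phi> ` carrier QP" and x: "x \<in> carrier K.GP"
      and states: "\<And>w t. w \<in> V \<Longrightarrow> t \<in> carrier (?K w) \<Longrightarrow> retract w q \<otimes>\<^bsub>G w\<^esub> \<theta> w t \<in> window w" for q x
    using x
  proof (induction rule: K.gp_induct)
    case one
    then show ?case using q \<Theta>1 by (simp add: in_image_iff)
  next
    case (step x w t)
    interpret Gw: group "G w" by (rule factors[OF step.hyps(2)])
    interpret Kw: group "?K w" by (rule K.factors[OF step.hyps(2)])
    let ?a = "K.retract w x"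
    let ?g = "inv\<^bsub>G w\<^esub> (\<theta> w ?a) \<otimes>\<^bsub>G w\<^esub> \<theta> w (?a \<otimes>\<^bsub>?K w\<^esub> t)"
    have qc: "q \<in> carrier GP" using q by (simp add: in_image_iff)
    have a: "?a \<in> carrier (?K w)" by (rule K.retract_closed[OF step.hyps(2,1)])
    have at: "?a \<otimes>\<^bsub>?K w\<^esub> t \<in> carrier (?K w)" using a step.hyps(3) by simp
    have \<theta>a: "\<theta> w ?a \<in> carrier (G w)" "\<theta> w (?a \<otimes>\<^bsub>?K w\<^esub> t) \<in> carrier (G w)"
      using \<theta>c[OF step.hyps(2)] a at by auto
    then have g: "?g \<in> carrier (G w)" by simp
    have rq: "retract w q \<in> carrier (G w)" by (rule retract_closed[OF step.hyps(2) qc])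
    have "retract w (q \<otimes>\<^bsub>GP\<^esub> \<Theta> x) \<otimes>\<^bsub>G w\<^esub> ?g = retract w q \<otimes>\<^bsub>G w\<^esub> (\<theta> w ?a \<otimes>\<^bsub>G w\<^esub> ?g)"
      using rq \<theta>a g by (simp add: retract_mult[OF step.hyps(2) qc \<Theta>c[OF step.hyps(1)]]
          \<Theta>_retract[OF step.hyps(1,2)] Gw.m_assoc)
    also have "\<theta> w ?a \<otimes>\<^bsub>G w\<^esub> ?g = \<theta> w (?a \<otimes>\<^bsub>?K w\<^esub> t)"
      using \<theta>a by (simp add: Gw.m_assoc[symmetric])
    finally have "retract w (q \<otimes>\<^bsub>GP\<^esub> \<Theta> x) \<otimes>\<^bsub>G w\<^esub> ?g \<in> window w"
      using states[OF step.hyps(2) at] by simp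
    from image_step[OF step.IH step.hyps(2) g this]
    have "q \<otimes>\<^bsub>GP\<^esub> \<Theta> x \<otimes>\<^bsub>GP\<^esub> incl w ?g \<in> \<phi> ` carrier QP" .
    moreover have "\<Theta> (x \<otimes>\<^bsub>K.GP\<^esub> K.incl w t) = \<Theta> x \<otimes>\<^bsub>GP\<^esub> incl w ?g"
      using \<Theta> step.hyps unfolding gp_lifts_def by auto
    ultimately show ?case
      using qc \<Theta>c[OF step.hyps(1)] incl_closed[OF step.hyps(2) g] by (simp add: P.m_assoc)
  qed

  have in_Y: "\<Theta> x \<in> \<phi> ` carrier QP" if x: "x \<in> carrier K.GP" for x
  proof -
    have "\<one>\<^bsub>GP\<^esub> \<otimes>\<^bsub>GP\<^esub> \<Theta> x \<in> \<phi> ` carrier QP"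
    proof (rule \<Theta>_image[OF one_image x])
      fix w t assume w: "w \<in> V" "t \<in> carrier (?K w)"
      interpret Gw: group "G w" by (rule factors[OF w(1)])
      have "\<theta> w t \<in> carrier (G w)" using \<theta>c[OF w(1)] w(2) by auto
      then show "retract w \<one>\<^bsub>GP\<^esub> \<otimes>\<^bsub>G w\<^esub> \<theta> w t \<in> window w"
        using \<theta>w[OF w] by (simp add: retract_one[OF w(1)])
    qed
    then show ?thesis using \<Theta>c[OF x] by simp
  qed
  let ?q = "incl u (inv\<^bsub>G u\<^esub> s)"
  have qc: "?q \<in> carrier GP" using sc uv(1) by (simp add: incl_closed)
  have q_image: "?q \<in> \<phi> ` carrier QP"
    using image_step[OF one_image uv(1), of "inv\<^bsub>G u\<^esub> s"] sc s(2) qc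
    by (simp add: retract_one[OF uv(1)])
  have in_Y': "?q \<otimes>\<^bsub>GP\<^esub> \<Theta> x \<in> \<phi> ` carrier QP" if x: "x \<in> carrier K.GP" for x
  proof (rule \<Theta>_image[OF q_image x])
    fix w t assume w: "w \<in> V" "t \<in> carrier (?K w)"
    interpret Gw: group "G w" by (rule factors[OF w(1)])
    have c: "\<theta> w t \<in> carrier (G w)" using \<theta>c[OF w(1)] w(2) by auto
    have r: "retract w ?q = (if u = w then inv\<^bsub>G u\<^esub> s else \<one>\<^bsub>G w\<^esub>)"
      using retract_props(2)[OF w(1) uv(1)] sc by simp
    show "retract w ?q \<otimes>\<^bsub>G w\<^esub> \<theta> w t \<in> window w"
    proof (cases "u = w")
      case True
      then have "\<theta> w t = \<one>\<^bsub>G u\<^esub> \<or> \<theta> w t = s" by (simp add: \<theta>_def)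
      then have "inv\<^bsub>G u\<^esub> s \<otimes>\<^bsub>G u\<^esub> \<theta> w t \<in> {inv\<^bsub>G u\<^esub> s, \<one>\<^bsub>G u\<^esub>}" using sc by auto
      then have "inv\<^bsub>G u\<^esub> s \<otimes>\<^bsub>G u\<^esub> \<theta> w t \<in> window u"
        using s(2) one_window[OF uv(1)] by (elim insertE emptyE) (simp_all only:)
      then show ?thesis using True r by simp
    next
      case False
      then show ?thesis using r c \<theta>w[OF w] by simp
    qed
  qed
  have pq: "p \<otimes>\<^bsub>GP\<^esub> incl u s \<otimes>\<^bsub>GP\<^esub> (?q \<otimes>\<^bsub>GP\<^esub> y) = p \<otimes>\<^bsub>GP\<^esub> y" if "y \<in> carrier GP" for y
  proof -
    have "incl u s \<otimes>\<^bsub>GP\<^esub> (?q \<otimes>\<^bsub>GP\<^esub> y) = y"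
      using that sc uv(1) by (simp add: incl_inv incl_closed P.m_assoc[symmetric])
    then show ?thesis using p that qc sc uv(1) by (simp add: P.m_assoc incl_closed)
  qed
  have both: "p \<otimes>\<^bsub>GP\<^esub> \<Theta> x \<in> ?Y \<inter> ?Y'" if x: "x \<in> carrier K.GP" for x
  proof
    show "p \<otimes>\<^bsub>GP\<^esub> \<Theta> x \<in> ?Y" using in_Y[OF x] by blast
    show "p \<otimes>\<^bsub>GP\<^esub> \<Theta> x \<in> ?Y'" using in_Y'[OF x] pq[OF \<Theta>c[OF x], symmetric] by blast
  qed

  let ?T = "\<Union>v\<in>V. K.incl v ` carrier (?K v)"
  interpret CK: cayley_graph K.GP ?T
    by unfold_locales (rule K.finite_generating_set_factors[OF finV finK])
  have \<Theta>_lip: "CP.cdist (\<Theta> x) (\<Theta> y) \<le> A * CK.cdist x y" if "x \<in> carrier K.GP" "y \<in> carrier K.GP" for x y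
    by (rule gp_lifts_lipschitz[OF K.group_graph_axioms group_graph_axioms \<Theta> \<theta>c finV finK S A[OF _ \<theta>w \<theta>w] that])
  let ?word = "modular_word V E u v"
  have wc: "?word cs \<in> carrier K.GP" for cs by (rule modular_word_closed[OF simple uv(1-3)])
  have len: "CK.cdist \<one>\<^bsub>K.GP\<^esub> (?word cs) \<le> 2 * real (length cs)" for cs
  proof (induction cs)
    case Nil
    then show ?case by (simp add: modular_word_def)
  next
    case (Cons c cs)
    let ?a = "K.incl v (if c then 1 else 2)" and ?b = "K.incl u 1"
    note g = modular_generators[OF uv(3)]
    have ab: "?a \<in> ?T" "?b \<in> ?T" using g(1) g(2)[of c] uv(1,2) by blast+
    have abc: "?a \<in> carrier K.GP" "?b \<in> carrier K.GP"
      using g(1) g(2)[of c] uv(1,2) by (auto intro: K.incl_closed)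
    have "CK.cdist \<one>\<^bsub>K.GP\<^esub> (?a \<otimes>\<^bsub>K.GP\<^esub> ?b) \<le> CK.cdist \<one>\<^bsub>K.GP\<^esub> ?a + CK.cdist ?a (?a \<otimes>\<^bsub>K.GP\<^esub> ?b)"
      by (rule CK.cdist_triangle) (use abc in auto)
    also have "\<dots> \<le> 2"
      using CK.cdist_generator[OF K.P.one_closed ab(1)] CK.cdist_generator[OF abc(1) ab(2)] abc by simp
    finally have 2: "CK.cdist \<one>\<^bsub>K.GP\<^esub> (?a \<otimes>\<^bsub>K.GP\<^esub> ?b) \<le> 2" .
    have "CK.cdist \<one>\<^bsub>K.GP\<^esub> (?word (c # cs)) \<le> CK.cdist \<one>\<^bsub>K.GP\<^esub> (?a \<otimes>\<^bsub>K.GP\<^esub> ?b) +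
        CK.cdist (?a \<otimes>\<^bsub>K.GP\<^esub> ?b) (?a \<otimes>\<^bsub>K.GP\<^esub> ?b \<otimes>\<^bsub>K.GP\<^esub> ?word cs)"
      unfolding modular_word_Cons by (rule CK.cdist_triangle) (use abc wc in auto)
    also have "CK.cdist (?a \<otimes>\<^bsub>K.GP\<^esub> ?b) (?a \<otimes>\<^bsub>K.GP\<^esub> ?b \<otimes>\<^bsub>K.GP\<^esub> ?word cs) = CK.cdist \<one>\<^bsub>K.GP\<^esub> (?word cs)"
      using CK.cdist_translate[of "?a \<otimes>\<^bsub>K.GP\<^esub> ?b" "\<one>\<^bsub>K.GP\<^esub>" "?word cs"] abc wc by simp
    finally show ?case using 2 Cons.IH by simp
  qed

  show ?thesis
    unfolding exp_overlap_def
  proof (intro bexI[of _ p] allI)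
    show "p \<in> ?Y \<inter> ?Y'" using both[OF K.P.one_closed] p by (simp add: \<Theta>1)
    fix m :: nat
    let ?B = "{q \<in> ?Y \<inter> ?Y'. CP.cdist p q \<le> 2 * A * real m}"
    let ?L = "{cs :: bool list. length cs = m}"
    have "?Y \<subseteq> carrier GP" using p by (auto simp: \<phi>_closed)
    then have "finite ?B"
      by (intro rev_finite_subset[OF CP.finite_cball[OF p, of "2 * A * real m"]]) auto
    moreover have "(\<lambda>cs. p \<otimes>\<^bsub>GP\<^esub> \<Theta> (?word cs)) ` ?L \<subseteq> ?B"
    proof
      fix q assume "q \<in> (\<lambda>cs. p \<otimes>\<^bsub>GP\<^esub> \<Theta> (?word cs)) ` ?L"
      then obtain cs where q: "q = p \<otimes>\<^bsub>GP\<^esub> \<Theta> (?word cs)" and cs: "length cs = m" by auto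
      have "CP.cdist p q = CP.cdist \<one>\<^bsub>GP\<^esub> (\<Theta> (?word cs))"
        using CP.cdist_translate[OF p P.one_closed \<Theta>c[OF wc]] p by (simp add: q)
      also have "\<dots> \<le> A * CK.cdist \<one>\<^bsub>K.GP\<^esub> (?word cs)"
        using \<Theta>_lip[OF K.P.one_closed wc] by (simp add: \<Theta>1)
      also have "\<dots> \<le> A * (2 * real m)"
        using len[of cs] A_pos cs by (intro mult_left_mono) auto
      finally have "CP.cdist p q \<le> 2 * A * real m" by simp
      with both[OF wc] show "q \<in> ?B" by (simp add: q)
    qed
    moreover have "inj_on (\<lambda>cs. p \<otimes>\<^bsub>GP\<^esub> \<Theta> (?word cs)) ?L"
    proof (rule inj_onI)
      fix cs ds assume cd: "cs \<in> ?L" "ds \<in> ?L" and eq: "p \<otimes>\<^bsub>GP\<^esub> \<Theta> (?word cs) = p \<otimes>\<^bsub>GP\<^esub> \<Theta> (?word ds)"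
      have "\<Theta> (?word cs) = \<Theta> (?word ds)" using eq p \<Theta>c[OF wc] by simp
      then have "?word cs = ?word ds" using inj_onD[OF inj_\<Theta>] wc by blast
      then show "cs = ds" using inj_onD[OF inj_on_modular_word[OF simple uv]] cd by blast
    qed
    ultimately have "card ?L \<le> card ?B" by (intro card_inj_on_le)
    moreover have "card ?L = 2 ^ m"
      using card_lists_length_eq[of "UNIV :: bool set" m] by simp
    ultimately show "2 ^ m \<le> card ?B" by simp
  qed
qed

end

context gp_window begin

definition copies :: "(('v \<times> int) list set \<Rightarrow> ('v \<times> 'a) list set) set" where
  "copies = (\<lambda>p x. p \<otimes>\<^bsub>GP\<^esub> \<phi> x) ` carrier GP"

definition overlapping where
  "overlapping = {(a, b). a \<in> copies \<and> b \<in> copies \<and>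
     exp_overlap CP.cdist (2 * A) (a ` carrier QP) (b ` carrier QP)}"

lemma sym_overlapping: "sym (overlapping\<^sup>*)"
  by (rule sym_rtrancl) (auto simp: sym_def overlapping_def exp_overlap_sym)

text \<open>By \<open>overlap_translate\<close>, the copies based at \<open>p\<close> and \<open>p s\<close> overlap for every chosen generator \<open>s \<noteq> 1\<close> of
  a factor, and these generators together generate \<open>P\<close>.\<close>
lemma copies_linked:
  assumes not_join: "\<And>u. u \<in> V \<Longrightarrow> \<exists>v\<in>V. u \<noteq> v \<and> {u, v} \<notin> E"
    and gens: "\<And>u. u \<in> V \<Longrightarrow> R u \<subseteq> carrier (G u) \<and> generate (G u) (R u) = carrier (G u)"
    and R: "\<And>u s. u \<in> V \<Longrightarrow> s \<in> R u \<Longrightarrow> s \<in> window u \<and> inv\<^bsub>G u\<^esub> s \<in> window u"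
    and ab: "a \<in> copies" "b \<in> copies"
  shows "(a, b) \<in> overlapping\<^sup>*"
proof -
  let ?c = "\<lambda>p x. p \<otimes>\<^bsub>GP\<^esub> \<phi> x"
  have base: "(?c p, ?c (p \<otimes>\<^bsub>GP\<^esub> incl u s)) \<in> overlapping\<^sup>*"
    if p: "p \<in> carrier GP" and u: "u \<in> V" and s: "s \<in> R u" for p u s
  proof (cases "s = \<one>\<^bsub>G u\<^esub>")
    case True
    then show ?thesis using p u by (simp add: incl_one)
  next
    case False
    obtain v where v: "v \<in> V" "u \<noteq> v" "{u, v} \<notin> E" using not_join[OF u] by blast
    have "s \<in> carrier (G u)" using gens[OF u] s by blast
    then have "p \<otimes>\<^bsub>GP\<^esub> incl u s \<in> carrier GP" using p u by (simp add: incl_closed)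
    moreover have "exp_overlap CP.cdist (2 * A) (?c p ` carrier QP) (?c (p \<otimes>\<^bsub>GP\<^esub> incl u s) ` carrier QP)"
      using overlap_translate[OF p u v] R[OF u s] False by (simp add: image_image)
    ultimately have "(?c p, ?c (p \<otimes>\<^bsub>GP\<^esub> incl u s)) \<in> overlapping"
      using p unfolding overlapping_def copies_def by auto
    then show ?thesis by (rule r_into_rtrancl)
  qed
  have factor: "(?c p, ?c (p \<otimes>\<^bsub>GP\<^esub> incl u g)) \<in> overlapping\<^sup>*"
    if u: "u \<in> V" and "g \<in> generate (G u) (R u)" and "p \<in> carrier GP" for p u g
    using that(2,3)
  proof (induction arbitrary: p)
    case one
    then show ?case using u by (simp add: incl_one)
  next
    case (incl s)
    then show ?case using base u by blast
  next
    case (inv s)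
    interpret Gu: group "G u" by (rule factors[OF u])
    have s: "s \<in> carrier (G u)" using gens[OF u] inv.hyps by blast
    let ?q = "p \<otimes>\<^bsub>GP\<^esub> incl u (inv\<^bsub>G u\<^esub> s)"
    have q: "?q \<in> carrier GP" using inv.prems s u by (simp add: incl_closed)
    have "?q \<otimes>\<^bsub>GP\<^esub> incl u s = p"
      using inv.prems s u by (simp add: incl_inv incl_closed P.m_assoc)
    with base[OF q u inv.hyps] have "(?c ?q, ?c p) \<in> overlapping\<^sup>*" by simp
    then show ?case by (rule symD[OF sym_overlapping])
  next
    case (eng g k)
    have c: "g \<in> carrier (G u)" "k \<in> carrier (G u)" using gens[OF u] eng.hyps by auto
    have "(?c p, ?c (p \<otimes>\<^bsub>GP\<^esub> incl u g)) \<in> overlapping\<^sup>*" by (rule eng.IH(1)[OF eng.prems])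
    also have "(?c (p \<otimes>\<^bsub>GP\<^esub> incl u g), ?c (p \<otimes>\<^bsub>GP\<^esub> incl u g \<otimes>\<^bsub>GP\<^esub> incl u k)) \<in> overlapping\<^sup>*"
      by (rule eng.IH(2)) (use eng.prems c u in \<open>simp add: incl_closed\<close>)
    also have "p \<otimes>\<^bsub>GP\<^esub> incl u g \<otimes>\<^bsub>GP\<^esub> incl u k = p \<otimes>\<^bsub>GP\<^esub> incl u (g \<otimes>\<^bsub>G u\<^esub> k)"
      using eng.prems c u by (simp add: incl_mult incl_closed P.m_assoc)
    finally show ?case .
  qed
  have all: "(?c \<one>\<^bsub>GP\<^esub>, ?c p) \<in> overlapping\<^sup>*" if "p \<in> carrier GP" for p
    using that
  proof (induction rule: gp_induct)
    case (step x u g)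
    have "(?c x, ?c (x \<otimes>\<^bsub>GP\<^esub> incl u g)) \<in> overlapping\<^sup>*"
      by (rule factor[OF step.hyps(2) _ step.hyps(1)]) (use gens[OF step.hyps(2)] step.hyps(3) in simp)
    with step.IH show ?case by (rule rtrancl_trans)
  qed simp
  obtain p where p: "a = ?c p" "p \<in> carrier GP" using ab(1) unfolding copies_def by (rule imageE)
  obtain q where q: "b = ?c q" "q \<in> carrier GP" using ab(2) unfolding copies_def by (rule imageE)
  show ?thesis
    unfolding p q by (rule rtrancl_trans[OF symD[OF sym_overlapping all[OF p(2)]] all[OF q(2)]])
qed

theorem window_separable:
  assumes not_join: "\<And>u. u \<in> V \<Longrightarrow> \<exists>v\<in>V. u \<noteq> v \<and> {u, v} \<notin> E"
    and gens: "\<And>u. u \<in> V \<Longrightarrow> R u \<subseteq> carrier (G u) \<and> generate (G u) (R u) = carrier (G u)"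
    and R: "\<And>u s. u \<in> V \<Longrightarrow> s \<in> R u \<Longrightarrow> s \<in> window u \<and> inv\<^bsub>G u\<^esub> s \<in> window u"
    and sep: "coarsely_separated (carrier GP) CP.cdist \<Z>"
    and sub: "subexponential_growth (carrier GP) CP.cdist \<Z>"
  shows "subexp_coarsely_separable QP"
proof (rule coarse_separation_transfer[OF CP.cayley_graph_axioms CQ.cayley_graph_axioms sep sub A_pos, where \<Phi> = copies and B = "2 * A"])
  show "2 * A > 0" using A_pos by simp
  show "a \<in> carrier QP \<rightarrow> carrier GP" if "a \<in> copies" for a
    using that by (auto simp: copies_def \<phi>_closed)
  show "inj_on a (carrier QP)" if "a \<in> copies" for a
  proof (rule inj_onI)
    fix x y assume xy: "x \<in> carrier QP" "y \<in> carrier QP" and "a x = a y"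
    then have "\<phi> x = \<phi> y" using that \<phi>_closed by (auto simp: copies_def)
    then show "x = y" using inj_onD[OF inj_\<phi>] xy by blast
  qed
  show "CP.cdist (a x) (a y) \<le> A * CQ.cdist x y"
    if a: "a \<in> copies" and "x \<in> carrier QP" "y \<in> carrier QP" for a x y
  proof -
    obtain p where "a = (\<lambda>x. p \<otimes>\<^bsub>GP\<^esub> \<phi> x)" "p \<in> carrier GP"
      using a unfolding copies_def by (rule imageE)
    then show ?thesis
      using \<phi>_lipschitz[OF that(2,3)] CP.cdist_translate \<phi>_closed that(2,3) by simp
  qed
  show "\<exists>a\<in>copies. p \<in> a ` carrier QP" if p: "p \<in> carrier GP" for p
  proof -
    obtain x where x: "x \<in> carrier QP" "\<phi> x = \<one>\<^bsub>GP\<^esub>" using one_image by auto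
    then have "p = p \<otimes>\<^bsub>GP\<^esub> \<phi> x" using p by simp
    with x(1) p show ?thesis
      by (intro bexI[of _ "\<lambda>x. p \<otimes>\<^bsub>GP\<^esub> \<phi> x"]) (auto simp: copies_def)
  qed
  show "(a, b) \<in> {(a, b). a \<in> copies \<and> b \<in> copies \<and>
      exp_overlap CP.cdist (2 * A) (a ` carrier QP) (b ` carrier QP)}\<^sup>*"
    if "a \<in> copies" "b \<in> copies" for a b
    using copies_linked[OF not_join gens R that] unfolding overlapping_def .
qed

end

text \<open>A vertex adjacent to all others would make the graph the join of this vertex and the rest.\<close>
lemma exists_nonadjacent:
  assumes "\<not> is_join V E" "card V \<ge> 2" "u \<in> V"
  shows "\<exists>v\<in>V. u \<noteq> v \<and> {u, v} \<notin> E"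
proof (rule ccontr)
  assume all: "\<not> (\<exists>v\<in>V. u \<noteq> v \<and> {u, v} \<notin> E)"
  have "V - {u} \<noteq> {}"
  proof
    assume "V - {u} = {}"
    then have "V = {u}" using assms(3) by auto
    then show False using assms(2) by simp
  qed
  with all assms(3) have "is_join V E"
    unfolding is_join_def by (intro exI[of _ "{u}"] exI[of _ "V - {u}"]) auto
  with assms(1) show False by blast
qed

theorem theorem5p1:
  fixes V :: "'v set" and E :: "'v set set" and G :: "'v \<Rightarrow> ('a, 'b) monoid_scheme"
  assumes "simple_graph V E" and "finite V"
    and "\<And>u. u \<in> V \<Longrightarrow> group (G u)"
    and "\<And>u. u \<in> V \<Longrightarrow> infinite (carrier (G u))"
    and "\<And>u. u \<in> V \<Longrightarrow> finitely_generated (G u)"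
    and "\<not> is_join V E"
    and "card V \<ge> 2"
    and "subexp_coarsely_separable (graph_product V E G)"
  shows "\<forall>k::nat. \<exists>\<nu> :: 'v \<Rightarrow> nat. (\<forall>u\<in>V. \<nu> u \<ge> 2 \<and> \<nu> u \<ge> k) \<and>
           subexp_coarsely_separable (graph_product V E (\<lambda>u. integer_mod_group (\<nu> u)))"
proof
  fix k :: nat
  interpret group_graph V E G using assms by (simp add: group_graph_def)
  obtain S \<Z> where S: "finite_generating_set GP S"
    and sep: "coarsely_separated (carrier GP) (cayley_dist GP S) \<Z>"
    and sub: "subexponential_growth (carrier GP) (cayley_dist GP S) \<Z>"
    using assms(8) unfolding subexp_coarsely_separable_def by blast
  interpret C: cayley_graph GP S by unfold_locales (rule S)
  obtain R where R: "\<And>u. u \<in> V \<Longrightarrow> finite_generating_set (G u) (R u)"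
    using assms(5) unfolding finitely_generated_def by metis
  define F where "F u = insert \<one>\<^bsub>G u\<^esub> (R u \<union> (\<lambda>s. inv\<^bsub>G u\<^esub> s) ` R u)" for u
  \<comment> \<open>Three labels are needed to carry the cyclic group of order 3; the sum makes room for all of the sets
    \<open>F u\<close> in windows of the same size.\<close>
  define n where "n = k + 3 + (\<Sum>u\<in>V. card (F u))"
  have F: "finite (F u)" "F u \<subseteq> carrier (G u)" "card (F u) \<le> n" if u: "u \<in> V" for u
  proof -
    interpret Gu: group "G u" by (rule factors[OF u])
    show "finite (F u)" "F u \<subseteq> carrier (G u)"
      using R[OF u] by (auto simp: F_def finite_generating_set_def)
    show "card (F u) \<le> n" using member_le_sum[OF u, of "\<lambda>u. card (F u)"] assms(2) by (simp add: n_def)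
  qed
  have "\<exists>fh. fst fh \<in> {0..<int n} \<rightarrow> carrier (G u) \<and> snd fh \<in> carrier (G u) \<rightarrow> {0..<int n} \<and>
      fst fh 0 = \<one>\<^bsub>G u\<^esub> \<and> snd fh \<one>\<^bsub>G u\<^esub> = 0 \<and> (\<forall>a\<in>{0..<int n}. snd fh (fst fh a) = a) \<and> F u \<subseteq> fst fh ` {0..<int n}"
    if u: "u \<in> V" for u
    using cyclic_labelling[OF assms(4)[OF u] F(1,2)[OF u] _ F(3)[OF u], of "\<one>\<^bsub>G u\<^esub>"]
    by (auto simp: F_def)
  then obtain fh where fh: "\<And>u. u \<in> V \<Longrightarrow> fst (fh u) \<in> {0..<int n} \<rightarrow> carrier (G u) \<and>
      snd (fh u) \<in> carrier (G u) \<rightarrow> {0..<int n} \<and> fst (fh u) 0 = \<one>\<^bsub>G u\<^esub> \<and> snd (fh u) \<one>\<^bsub>G u\<^esub> = 0 \<and>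
      (\<forall>a\<in>{0..<int n}. snd (fh u) (fst (fh u) a) = a) \<and> F u \<subseteq> fst (fh u) ` {0..<int n}"
    by metis
  define f h where "f u = fst (fh u)" and "h u = snd (fh u)" for u
  have f: "f u \<in> {0..<int n} \<rightarrow> carrier (G u)" and h: "h u \<in> carrier (G u) \<rightarrow> {0..<int n}"
    and f0: "f u 0 = \<one>\<^bsub>G u\<^esub>" and h0: "h u \<one>\<^bsub>G u\<^esub> = 0" and FW: "F u \<subseteq> f u ` {0..<int n}"
    and hf: "\<And>a. a \<in> {0..<int n} \<Longrightarrow> h u (f u a) = a" if "u \<in> V" for u
    using fh[OF that] by (auto simp: f_def h_def)
  have n3: "n \<ge> 3" by (simp add: n_def)
  have carr: "carrier (integer_mod_group n) = {0..<int n}" using n3 by (simp add: carrier_integer_mod_group)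
  interpret Q: group_graph V E "\<lambda>_. integer_mod_group n" by (simp add: group_graph_def simple)
  obtain \<phi> where \<phi>: "gp_lifts V E (\<lambda>_. integer_mod_group n) G f \<phi>"
    using gp_lifts_exists[OF Q.group_graph_axioms group_graph_axioms, of f] f f0 by (auto simp: carr)
  obtain \<psi> where \<psi>: "gp_lifts V E G (\<lambda>_. integer_mod_group n) h \<psi>"
    using gp_lifts_exists[OF group_graph_axioms Q.group_graph_axioms, of h] h h0 by (auto simp: carr)
  define \<D> where "\<D> = (\<lambda>(u, a, b). C.cdist \<one>\<^bsub>GP\<^esub> (incl u (inv\<^bsub>G u\<^esub> f u a \<otimes>\<^bsub>G u\<^esub> f u b))) `
    (V \<times> {0..<int n} \<times> {0..<int n})"
  define A where "A = Max (insert 1 \<D>)"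
  have fin: "finite (insert 1 \<D>)" using assms(2) by (simp add: \<D>_def)
  have A_pos: "A > 0" using Max_ge[OF fin, of 1] by (simp add: A_def)
  have A: "C.cdist \<one>\<^bsub>GP\<^esub> (incl u (inv\<^bsub>G u\<^esub> a \<otimes>\<^bsub>G u\<^esub> b)) \<le> A"
    if "u \<in> V" "a \<in> f u ` {0..<int n}" "b \<in> f u ` {0..<int n}" for u a b
    unfolding A_def by (rule Max_ge[OF fin]) (use that in \<open>force simp: \<D>_def\<close>)
  interpret W: gp_window V E G n f h \<phi> \<psi> S A
    using assms(2) n3 f h f0 hf \<phi> \<psi> S A_pos A by unfold_locales
  have "subexp_coarsely_separable (graph_product V E (\<lambda>_. integer_mod_group n))"
  proof (rule W.window_separable[OF _ _ _ sep sub])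
    show "\<exists>v\<in>V. u \<noteq> v \<and> {u, v} \<notin> E" if "u \<in> V" for u
      by (rule exists_nonadjacent[OF assms(6,7) that])
    show "R u \<subseteq> carrier (G u) \<and> generate (G u) (R u) = carrier (G u)" if "u \<in> V" for u
      using R[OF that] by (simp add: finite_generating_set_def)
    show "s \<in> f u ` {0..<int n} \<and> inv\<^bsub>G u\<^esub> s \<in> f u ` {0..<int n}" if "u \<in> V" "s \<in> R u" for u s
      using FW[OF that(1)] that(2) by (auto simp: F_def)
  qed
  then show "\<exists>\<nu> :: 'v \<Rightarrow> nat. (\<forall>u\<in>V. \<nu> u \<ge> 2 \<and> \<nu> u \<ge> k) \<and>
           subexp_coarsely_separable (graph_product V E (\<lambda>u. integer_mod_group (\<nu> u)))"
    by (intro exI[of _ "\<lambda>_. n"]) (simp add: n_def)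
qed

end
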